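(* Let $r\ge 1$, $i\ge 0$, $k\ge 0$ be fixed integers such that either ($r\le 10$, $i+k\le 100$ and $k\le 27$), or $i+k\le 29$ (with $r$ arbitrary). For each $n$ choose a graph uniformly at random among the $r$-regular bipartite graphs with $v=2n$ vertices. Then $$\Pr\bigl(\Delta^k d(i)\ge 0\bigr)\longrightarrow 1\qquad\text{as } n\to\infty .$$
   Context: For an $r$-regular bipartite graph with $v=2n$ vertices let $m_i$ be its number of $i$-matchings (sets of $i$ pairwise vertex-disjoint edges; $m_0=1$), and let $\overline m_i=\frac{v!}{(v-2i)!\,i!\,2^i}$ be the number of $i$-matchings of the complete graph $K_v$. Define $$d(i)=\ln\Bigl(\frac{m_i}{r^i}\Bigr)-\ln\Bigl(\frac{\overline m_i}{(v-1)^i}\Bigr),$$ and let $\Delta$ be the forward difference operator $\Delta d(i)=d(i+1)-d(i)$, so that $\Delta^k d(i)=\sum_{\ell=0}^k(-1)^{k+\ell}\binom{k}{\ell}d(i+\ell)$. Since $r,i,k$ are fixed, $d(i),\dots,d(i+k)$ are defined for $n$ large. Graphs are simple, with labelled vertices and two vertex classes of size $n$; probability is with respect to the uniform distribution on all such $r$-regular bipartite graphs on $2n$ vertices. *)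

theory Defs
  imports "HOL-Probability.Probability"
begin

(* A graph on labelled vertices is given by its set of edges, and an edge is the
   two-element set of its endpoints, so there are no loops or multiple edges when the
   vertex classes A and B are disjoint. The classes are fixed: a graph counts once. *)

definition vdegree :: "'a set set \<Rightarrow> 'a \<Rightarrow> nat" where
  "vdegree E x = card {e \<in> E. x \<in> e}"

definition regular_bipartite_graphs :: "nat \<Rightarrow> 'a set \<Rightarrow> 'a set \<Rightarrow> 'a set set set" where
  "regular_bipartite_graphs r A B =
     {E. E \<subseteq> {{a, b} | a b. a \<in> A \<and> b \<in> B} \<and> (\<forall>x \<in> A \<union> B. vdegree E x = r)}"

definition matchings :: "'a set set \<Rightarrow> nat \<Rightarrow> 'a set set set" where
  "matchings E i = {M. M \<subseteq> E \<and> finite M \<and> card M = i \<and> pairwise disjnt M}"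

definition num_matchings :: "'a set set \<Rightarrow> nat \<Rightarrow> nat" where
  "num_matchings E i = card (matchings E i)"

(* The number of i-matchings of the complete graph on v vertices; meaningful for
   2 * i \<le> v only, because of the truncated subtraction. *)
definition complete_num_matchings :: "nat \<Rightarrow> nat \<Rightarrow> real" where
  "complete_num_matchings v i = fact v / (fact (v - 2 * i) * fact i * 2 ^ i)"

(* The quantity d(i) of an r-regular graph E with v vertices. It has its intended meaning
   if 2 * i \<le> v and E has an i-matching (recall ln 0 = 0); every nonempty regular bipartite
   graph has a perfect matching, so for bipartite E and r > 0 the former suffices. *)
definition log_matching_diff :: "nat \<Rightarrow> nat \<Rightarrow> 'a set set \<Rightarrow> nat \<Rightarrow> real" where
  "log_matching_diff r v E i =
     ln (real (num_matchings E i) / real r ^ i)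
     - ln (complete_num_matchings v i / (real v - 1) ^ i)"

definition fwd_diff :: "(nat \<Rightarrow> real) \<Rightarrow> nat \<Rightarrow> real" where
  "fwd_diff f i = f (i + 1) - f i"

end

theory Submission
  imports Defs "HOL-Library.Landau_Symbols"
begin

text \<open>
Write \<open>N = r n\<close> for the number of edges of the graph and compare \<open>m\<^sub>l\<close> with
\<open>\<mu>\<^sub>l = (binomial(n,l) r\<^sup>l)\<^sup>2 / binomial(N,l)\<close>, the mean number of \<open>l\<close>-matchings when the two
endpoints of the edges are paired at random. With \<open>R\<^sub>l = m\<^sub>l / \<mu>\<^sub>l\<close> one has
\<open>d(l) = ln R\<^sub>l + D(l)\<close>, where \<open>D\<close> is explicit and does not depend on the graph.

The explicit part is positive. The first difference of \<open>D\<close> is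
\<open>ln (n - l) - ln (r n - l) - ln (n - 1/2 - l)\<close> plus a constant, and the mean value theorem for
iterated differences gives \<open>\<Delta>\<^sup>k D \<ge> (k - 2)! / (r n)\<^sup>k\<^sup>-\<^sup>1\<close> for \<open>k \<ge> 2\<close>. Hence it suffices that
\<open>\<Delta>\<^sup>k ln R = O(n\<^sup>-\<^sup>k)\<close>. The cases \<open>k = 0, 1\<close> follow from \<open>k = 2\<close> because \<open>d(0) = d(1) = 0\<close>. Sequences
with \<open>\<Delta>\<^sup>j R = O(n\<^sup>-\<^sup>j)\<close> for all small \<open>j\<close> are closed under products by the Leibniz rule, hence under the
logarithm if \<open>R\<^sub>0 = 1\<close>, so everything rests on \<open>\<Delta>\<^sup>t R(0) = O(n\<^sup>-\<^sup>t)\<close> for each fixed \<open>t\<close>.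

This bound expresses an approximate independence. Call a set of edges a left (right) transversal if
its left (right) endpoints are distinct. For a uniformly random \<open>l\<close>-set of edges, \<open>R\<^sub>l\<close> is the
probability of being both, divided by the product of the two probabilities. As a uniformly random
subset of a random transversal is again a random transversal, \<open>R\<^sub>l\<close> is an inner product of two
consistent families of densities, and it splits along the eigenspaces of the Johnson scheme. The
kernel \<open>(-1)\<^sup>c / binomial(N - t, c)\<close>, a function of \<open>c = |X - Y|\<close> for \<open>t\<close>-sets \<open>X\<close> and \<open>Y\<close>, is a multiple of the
projection onto the top eigenspace. It annihilates every function of \<open>X\<close> that is a sum of
contributions of subsets with fewer than \<open>t\<close> elements
(\<open>sum_top_kernel_supersets\<close>). Pairing the two indicators
with this kernel has two consequences. On the one hand, Newton expansion of the kernel in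
\<open>|X \<inter> Y|\<close> yields \<open>\<Delta>\<^sup>t\<close> of \<open>R\<close> times a polynomial in \<open>l\<close> of degree \<open>t - 1\<close>, which determines \<open>\<Delta>\<^sup>t R(0)\<close>
up to lower differences. On the other hand, both indicators may be replaced by their Moebius
inverses (\<open>common_transversals_mobius_identity\<close>), giving a sum \<open>Z\<^sub>t\<close> over pairs \<open>(T, T')\<close>
in which every edge of \<open>T\<close> shares its left endpoint with another edge of \<open>T\<close>, and every edge of
\<open>T'\<close> shares its right endpoint with another edge of \<open>T'\<close>.

If \<open>|T - T'| = c\<close>, the left endpoints of \<open>T \<union> T'\<close> number at most \<open>t/2 + c\<close>, and so do the right ones,
while \<open>T \<union> T'\<close> has \<open>t + c\<close> edges. Thus the complete bipartite graph contains \<open>O(n\<^sup>t\<^sup>+\<^sup>2\<^sup>c)\<close> such pairs,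
and a switching argument shows that a given set of \<open>w\<close> edges lies in a random graph with
probability \<open>O(n\<^sup>-\<^sup>w)\<close> (\<open>num_containing_le\<close>). With the weight \<open>O(n\<^sup>-\<^sup>c)\<close> of the kernel, the mean
of \<open>|Z\<^sub>t|\<close> is \<open>O(1)\<close> (\<open>sum_abs_mobius_pair_sum_le\<close>). By Markov's inequality all \<open>Z\<^sub>t\<close> in question are at
most \<open>K\<close> outside an event of probability \<open>O(1/K)\<close>, and for each fixed \<open>K\<close> the difference
\<open>\<Delta>\<^sup>k d(i)\<close> is nonnegative on the remaining graphs once \<open>n\<close> is large
(\<open>eventually_diff_nonneg\<close>). Now let \<open>K\<close> tend to infinity.
\<close>

section \<open>Iterated forward differences\<close>

lemma fwd_diff_pow_Suc: "(fwd_diff ^^ Suc k) f i = (fwd_diff ^^ k) f (Suc i) - (fwd_diff ^^ k) f i"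
  by (simp add: fwd_diff_def)

lemma fwd_diff_pow_cong:
  assumes "\<And>l. i \<le> l \<Longrightarrow> l \<le> i + k \<Longrightarrow> f l = g l"
  shows "(fwd_diff ^^ k) f i = (fwd_diff ^^ k) g i"
  using assms
proof (induction k arbitrary: i)
  case (Suc k)
  have "(fwd_diff ^^ k) f i = (fwd_diff ^^ k) g i"
    by (rule Suc.IH) (auto intro: Suc.prems)
  moreover have "(fwd_diff ^^ k) f (Suc i) = (fwd_diff ^^ k) g (Suc i)"
    by (rule Suc.IH) (auto intro: Suc.prems)
  ultimately show ?case
    by (simp only: fwd_diff_pow_Suc)
qed simp

lemma fwd_diff_pow_add:
  "(fwd_diff ^^ k) (\<lambda>l. f l + g l) i = (fwd_diff ^^ k) f i + (fwd_diff ^^ k) g i"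
  by (induction k arbitrary: i) (simp_all add: fwd_diff_def)

lemma fwd_diff_pow_cmult:
  "(fwd_diff ^^ k) (\<lambda>l. c * f l) i = c * (fwd_diff ^^ k) f i"
  by (induction k arbitrary: i) (simp_all add: fwd_diff_def right_diff_distrib)

lemma fwd_diff_pow_sum:
  "(fwd_diff ^^ k) (\<lambda>l. \<Sum>s\<in>S. f s l) i = (\<Sum>s\<in>S. (fwd_diff ^^ k) (f s) i)"
  by (induction k arbitrary: i) (simp_all add: fwd_diff_def sum_subtractf)

lemma fwd_diff_pow_const: "(fwd_diff ^^ Suc k) (\<lambda>l. c) i = 0"
  by (induction k arbitrary: i) (simp_all add: fwd_diff_def)

lemma fwd_diff_pow_binomial_sum:
  "(fwd_diff ^^ k) f i = (\<Sum>l\<le>k. (-1) ^ (k - l) * real (k choose l) * f (i + l))"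
proof (induction k arbitrary: i)
  case (Suc k)
  have "(fwd_diff ^^ Suc k) f i = (fwd_diff ^^ k) f (Suc i) - (fwd_diff ^^ k) f i"
    by (rule fwd_diff_pow_Suc)
  also have "(fwd_diff ^^ k) f i = f i * (-1)^k - (\<Sum>l\<le>k. (-1) ^ (k - l) * real (k choose (Suc l)) * f (Suc i + l))"
  proof -
    have "(fwd_diff ^^ k) f i = (\<Sum>l\<le>Suc k. (-1) ^ (k - l) * real (k choose l) * f (i + l))"
      by (simp add: Suc.IH)
    also have "\<dots> = f i * (-1)^k + (\<Sum>l\<le>k. (-1) ^ (k - Suc l) * real (k choose (Suc l)) * f (Suc i + l))"
      by (subst sum.atMost_Suc_shift) (simp add: mult_ac)
    also have "(\<Sum>l\<le>k. (-1) ^ (k - Suc l) * real (k choose (Suc l)) * f (Suc i + l))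
       = (\<Sum>l\<le>k. - ((-1) ^ (k - l) * real (k choose (Suc l)) * f (Suc i + l)))"
    proof (intro sum.cong refl)
      fix l assume "l \<in> {..k}"
      show "(-1) ^ (k - Suc l) * real (k choose (Suc l)) * f (Suc i + l) = - ((-1) ^ (k - l) * real (k choose (Suc l)) * f (Suc i + l))"
      proof (cases "l < k")
        case True
        then have "k - l = Suc (k - Suc l)" by simp
        then show ?thesis by simp
      next
        case False
        then show ?thesis by (simp add: binomial_eq_0)
      qed
    qed
    finally show ?thesis by (simp add: sum_negf)
  qed
  also have "(fwd_diff ^^ k) f (Suc i) - (f i * (-1)^k - (\<Sum>l\<le>k. (-1) ^ (k - l) * real (k choose (Suc l)) * f (Suc i + l)))
     = (-1) ^ Suc k * f i + (\<Sum>l\<le>k. (-1) ^ (k - l) * real (Suc k choose Suc l) * f (Suc i + l))"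
    by (simp add: Suc.IH sum.distrib algebra_simps)
  also have "\<dots> = (\<Sum>l\<le>Suc k. (-1) ^ (Suc k - l) * real (Suc k choose l) * f (i + l))"
    by (subst sum.atMost_Suc_shift) simp
  finally show ?case .
qed simp

text \<open>Newton's interpolation formula, that is, the binomial theorem for
  the shift operator \<open>1 + \<Delta>\<close>.\<close>

lemma fwd_diff_pow_shift_newton:
  "(fwd_diff ^^ j) f (i + x) = (\<Sum>l\<le>x. real (x choose l) * (fwd_diff ^^ (j + l)) f i)"
proof (induction x arbitrary: i)
  case (Suc x)
  have step: "(fwd_diff ^^ m) f (Suc i) = (fwd_diff ^^ m) f i + (fwd_diff ^^ Suc m) f i" for m
    using fwd_diff_pow_Suc[of m f i] by linarith
  have "(fwd_diff ^^ j) f (i + Suc x) = (\<Sum>l\<le>x. real (x choose l) * (fwd_diff ^^ (j + l)) f (Suc i))"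
    using Suc.IH[of "Suc i"] by simp
  also have "\<dots> = (\<Sum>l\<le>x. real (x choose l) * (fwd_diff ^^ (j + l)) f i)
               + (\<Sum>l\<le>x. real (x choose l) * (fwd_diff ^^ (j + Suc l)) f i)"
    by (simp only: step distrib_left sum.distrib add_Suc_right)
  also have "(\<Sum>l\<le>x. real (x choose l) * (fwd_diff ^^ (j + l)) f i)
      = (\<Sum>l\<le>Suc x. real (x choose l) * (fwd_diff ^^ (j + l)) f i)"
    by simp
  also have "\<dots> = (fwd_diff ^^ j) f i + (\<Sum>l\<le>x. real (x choose Suc l) * (fwd_diff ^^ (j + Suc l)) f i)"
    by (subst sum.atMost_Suc_shift) simp
  also have "(fwd_diff ^^ j) f i + (\<Sum>l\<le>x. real (x choose Suc l) * (fwd_diff ^^ (j + Suc l)) f i)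
      + (\<Sum>l\<le>x. real (x choose l) * (fwd_diff ^^ (j + Suc l)) f i)
      = (fwd_diff ^^ j) f i + (\<Sum>l\<le>x. real (Suc x choose Suc l) * (fwd_diff ^^ (j + Suc l)) f i)"
    by (simp add: sum.distrib algebra_simps del: funpow.simps add_Suc_right)
  also have "\<dots> = (\<Sum>l\<le>Suc x. real (Suc x choose l) * (fwd_diff ^^ (j + l)) f i)"
    by (subst sum.atMost_Suc_shift) simp
  finally show ?case .
qed simp

text \<open>The Leibniz rule. The second factor is shifted because
  \<open>\<Delta>(f g)(l) = \<Delta>f(l) g(l + 1) + f(l) \<Delta>g(l)\<close>.\<close>

lemma fwd_diff_pow_mult:
  "(fwd_diff ^^ k) (\<lambda>l. f l * g l) i
     = (\<Sum>s\<le>k. real (k choose s) * (fwd_diff ^^ s) f i * (fwd_diff ^^ (k - s)) g (i + s))"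
proof (induction k arbitrary: i)
  case (Suc k)
  let ?F = "\<lambda>s. (fwd_diff ^^ s) f i" and ?G = "\<lambda>m s. (fwd_diff ^^ m) g (i + s)"
  have f_step: "(fwd_diff ^^ m) f (Suc i) = (fwd_diff ^^ m) f i + (fwd_diff ^^ Suc m) f i" for m
    using fwd_diff_pow_Suc[of m f i] by linarith
  have g_step: "?G m (Suc s) - ?G m s = ?G (Suc m) s" for m s
    using fwd_diff_pow_Suc[of m g "i + s"] by simp
  have "(fwd_diff ^^ Suc k) (\<lambda>l. f l * g l) i =
      (\<Sum>s\<le>k. real (k choose s) * ((?F s + ?F (Suc s)) * ?G (k - s) (Suc s) - ?F s * ?G (k - s) s))"
    by (simp only: fwd_diff_pow_Suc[of k "\<lambda>l. f l * g l"] Suc.IH f_step sum_subtractf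
        right_diff_distrib mult.assoc add_Suc add_Suc_right)
  also have "\<dots> = (\<Sum>s\<le>k. real (k choose s) * ?F s * ?G (Suc k - s) s)
      + (\<Sum>s\<le>k. real (k choose s) * ?F (Suc s) * ?G (k - s) (Suc s))"
    unfolding sum.distrib[symmetric]
  proof (intro sum.cong refl)
    fix s assume "s \<in> {..k}"
    then have "Suc k - s = Suc (k - s)" by auto
    then have eq: "?G (k - s) (Suc s) = ?G (k - s) s + ?G (Suc k - s) s"
      using g_step[of "k - s" s] by simp
    then show "real (k choose s) * ((?F s + ?F (Suc s)) * ?G (k - s) (Suc s) - ?F s * ?G (k - s) s) =
      real (k choose s) * ?F s * ?G (Suc k - s) s + real (k choose s) * ?F (Suc s) * ?G (k - s) (Suc s)"
      unfolding eq by algebra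
  qed
  also have "(\<Sum>s\<le>k. real (k choose s) * ?F s * ?G (Suc k - s) s) =
      (\<Sum>s\<le>Suc k. real (k choose s) * ?F s * ?G (Suc k - s) s)"
    by simp
  also have "\<dots> = ?F 0 * ?G (Suc k) 0 + (\<Sum>s\<le>k. real (k choose Suc s) * ?F (Suc s) * ?G (k - s) (Suc s))"
    by (subst sum.atMost_Suc_shift) (simp del: funpow.simps(2))
  also have "?F 0 * ?G (Suc k) 0 + (\<Sum>s\<le>k. real (k choose Suc s) * ?F (Suc s) * ?G (k - s) (Suc s))
      + (\<Sum>s\<le>k. real (k choose s) * ?F (Suc s) * ?G (k - s) (Suc s))
      = ?F 0 * ?G (Suc k) 0 + (\<Sum>s\<le>k. real (Suc k choose Suc s) * ?F (Suc s) * ?G (k - s) (Suc s))"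
    by (simp add: sum.distrib algebra_simps del: funpow.simps add_Suc_right)
  also have "\<dots> = (\<Sum>s\<le>Suc k. real (Suc k choose s) * ?F s * ?G (Suc k - s) s)"
    by (subst sum.atMost_Suc_shift) (simp del: funpow.simps(2))
  finally show ?case .
qed simp

text \<open>An iterated difference is an average of the derivative of the same order. The proof
  takes one difference of the whole family \<open>G\<close> of derivatives and uses the mean value theorem
  only for the last of them.\<close>

lemma fwd_diff_pow_ge:
  fixes G :: "nat \<Rightarrow> real \<Rightarrow> real"
  assumes deriv: "\<And>j x. j < h \<Longrightarrow> a \<le> x \<Longrightarrow> x \<le> b \<Longrightarrow> (G j has_real_derivative G (Suc j) x) (at x)"
    and lower: "\<And>x. a \<le> x \<Longrightarrow> x \<le> b \<Longrightarrow> c \<le> G h x"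
    and i: "a \<le> real i" "real i + real h \<le> b"
  shows "c \<le> (fwd_diff ^^ h) (\<lambda>l. G 0 (real l)) i"
  using assms
proof (induction h arbitrary: G b)
  case (Suc h)
  let ?H = "\<lambda>j x. G j (x + 1) - G j x"
  have d: "(?H j has_real_derivative ?H (Suc j) x) (at x)"
    if "j < h" "a \<le> x" "x \<le> b - 1" for j x
  proof -
    have 1: "(G j has_real_derivative G (Suc j) (x + 1)) (at (x + 1))"
      using that by (intro Suc.prems) auto
    have "((\<lambda>x. G j (x + 1)) has_real_derivative G (Suc j) (x + 1)) (at x)"
      using 1 by (simp add: DERIV_shift)
    moreover have "(G j has_real_derivative G (Suc j) x) (at x)"
      using that by (intro Suc.prems) auto
    ultimately show ?thesis by (rule DERIV_diff)
  qed
  have l: "c \<le> ?H h x" if x: "a \<le> x" "x \<le> b - 1" for x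
  proof -
    have "\<exists>z. x < z \<and> z < x + 1 \<and> G h (x + 1) - G h x = (x + 1 - x) * G (Suc h) z"
      using x by (intro MVT2) (auto intro!: Suc.prems)
    then show ?thesis using Suc.prems(2) x by force
  qed
  have "c \<le> (fwd_diff ^^ h) (\<lambda>l. ?H 0 (real l)) i"
    by (rule Suc.IH[of "b - 1"]) (use d l Suc.prems in auto)
  also have "(\<lambda>l. ?H 0 (real l)) = fwd_diff (\<lambda>l. G 0 (real l))"
    by (rule ext) (simp add: fwd_diff_def add.commute)
  also have "(fwd_diff ^^ h) (fwd_diff (\<lambda>l. G 0 (real l))) i = (fwd_diff ^^ Suc h) (\<lambda>l. G 0 (real l)) i"
    by (simp add: funpow_swap1)
  finally show ?case .
qed auto

section \<open>Slowly varying families and their logarithms\<close>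

text \<open>The families that behave like smooth functions of \<open>l / n\<close>. Only the values at arguments up to \<open>m\<close>
  enter, since only finitely many of the random quantities can be bounded at the same time. The
  filter is arbitrary so that \<open>x\<close> can range over pairs of a size and a graph.\<close>

definition slowly_varying :: "'x filter \<Rightarrow> ('x \<Rightarrow> nat) \<Rightarrow> nat \<Rightarrow> ('x \<Rightarrow> nat \<Rightarrow> real) \<Rightarrow> bool" where
  "slowly_varying F n m g \<longleftrightarrow>
     (\<forall>j l. j + l \<le> m \<longrightarrow> (\<lambda>x. (fwd_diff ^^ j) (g x) l) \<in> O[F](\<lambda>x. 1 / real (n x) ^ j))"

lemma slowly_varyingD:
  "slowly_varying F n m g \<Longrightarrow> j + l \<le> m \<Longrightarrow> (\<lambda>x. (fwd_diff ^^ j) (g x) l) \<in> O[F](\<lambda>x. 1 / real (n x) ^ j)"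
  by (simp add: slowly_varying_def)

lemma bigo_inverse_power_mono:
  assumes n: "filterlim n at_top F" and "i \<le> j"
  shows "(\<lambda>x. 1 / real (n x) ^ j) \<in> O[F](\<lambda>x. 1 / real (n x) ^ i)"
proof (rule bigoI[where c = 1])
  have "eventually (\<lambda>x. n x \<ge> 1) F" using n by (simp add: filterlim_at_top)
  then show "eventually (\<lambda>x. norm (1 / real (n x) ^ j) \<le> 1 * norm (1 / real (n x) ^ i)) F"
    by eventually_elim (use assms(2) in \<open>auto simp: divide_simps intro!: power_increasing\<close>)
qed

lemma slowly_varying_add:
  assumes "slowly_varying F n m f" "slowly_varying F n m g"
  shows "slowly_varying F n m (\<lambda>x l. f x l + g x l)"
  using assms by (simp add: slowly_varying_def fwd_diff_pow_add sum_in_bigo)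

lemma slowly_varying_cmult:
  assumes "slowly_varying F n m f"
  shows "slowly_varying F n m (\<lambda>x l. c * f x l)"
  using assms by (simp add: slowly_varying_def fwd_diff_pow_cmult)

lemma slowly_varying_sum:
  assumes "\<And>s. s \<in> S \<Longrightarrow> slowly_varying F n m (f s)"
  shows "slowly_varying F n m (\<lambda>x l. \<Sum>s\<in>S. f s x l)"
  using assms by (auto simp: slowly_varying_def fwd_diff_pow_sum intro!: big_sum_in_bigo)

lemma slowly_varying_const: "slowly_varying F n m (\<lambda>x l. c)"
  unfolding slowly_varying_def
proof (intro allI impI)
  fix j l
  show "(\<lambda>x. (fwd_diff ^^ j) (\<lambda>l. c) l) \<in> O[F](\<lambda>x. 1 / real (n x) ^ j)"
    by (cases j) (simp_all add: fwd_diff_pow_const del: funpow.simps(2))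
qed

lemma slowly_varying_mult:
  assumes f: "slowly_varying F n m f" and g: "slowly_varying F n m g"
  shows "slowly_varying F n m (\<lambda>x l. f x l * g x l)"
  unfolding slowly_varying_def
proof (intro allI impI)
  fix j l assume jl: "j + l \<le> m"
  show "(\<lambda>x. (fwd_diff ^^ j) (\<lambda>l. f x l * g x l) l) \<in> O[F](\<lambda>x. 1 / real (n x) ^ j)"
    unfolding fwd_diff_pow_mult
  proof (rule big_sum_in_bigo)
    fix s assume s: "s \<in> {..j}"
    have "(\<lambda>x. (fwd_diff ^^ s) (f x) l * (fwd_diff ^^ (j - s)) (g x) (l + s))
        \<in> O[F](\<lambda>x. 1 / real (n x) ^ s * (1 / real (n x) ^ (j - s)))"
      using s jl by (intro landau_o.big.mult slowly_varyingD[OF f] slowly_varyingD[OF g]) auto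
    then show "(\<lambda>x. real (j choose s) * (fwd_diff ^^ s) (f x) l * (fwd_diff ^^ (j - s)) (g x) (l + s))
        \<in> O[F](\<lambda>x. 1 / real (n x) ^ j)"
      using s by (simp add: mult.assoc flip: power_add)
  qed
qed

lemma slowly_varying_power:
  assumes "slowly_varying F n m f"
  shows "slowly_varying F n m (\<lambda>x l. f x l ^ s)"
  by (induction s) (simp_all add: slowly_varying_const slowly_varying_mult assms)

lemma slowly_varying_prod:
  assumes "\<And>s. s \<in> S \<Longrightarrow> slowly_varying F n m (f s)"
  shows "slowly_varying F n m (\<lambda>x l. \<Prod>s\<in>S. f s x l)"
  using assms
  by (induction S rule: infinite_finite_induct) (simp_all add: slowly_varying_const slowly_varying_mult)

lemma slowly_varying_linear:
  assumes n: "filterlim n at_top F" and r: "r \<ge> 1"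
  shows "slowly_varying F n m (\<lambda>x l. 1 - real (l + s) / real (r * n x))"
  unfolding slowly_varying_def
proof (intro allI impI)
  fix j l
  let ?f = "\<lambda>x l. 1 - real (l + s) / real (r * n x)"
  have n1: "eventually (\<lambda>x. n x \<ge> 1) F" using n by (simp add: filterlim_at_top)
  have d: "fwd_diff (?f x) = (\<lambda>l. - 1 / real (r * n x))" for x
    by (rule ext) (simp add: fwd_diff_def divide_simps)
  consider "j = 0" | "j = 1" | i where "j = Suc (Suc i)" by (metis One_nat_def not0_implies_Suc)
  then show "(\<lambda>x. (fwd_diff ^^ j) (?f x) l) \<in> O[F](\<lambda>x. 1 / real (n x) ^ j)"
  proof cases
    case 1
    have "eventually (\<lambda>x. norm (?f x l) \<le> (1 + real (l + s)) * norm (1::real)) F"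
      using n1
    proof eventually_elim
      case (elim x)
      define c d where "c = real (l + s)" and "d = real (l + s) / real (r * n x)"
      have "d \<le> real (l + s) / 1"
        unfolding d_def using elim r by (intro divide_left_mono) (auto simp flip: of_nat_mult)
      then have "0 \<le> c" "0 \<le> d" "d \<le> c" by (simp_all add: c_def d_def)
      then have "\<bar>1 - d\<bar> \<le> 1 + c" by linarith
      then show ?case by (simp add: c_def d_def)
    qed
    then have "(\<lambda>x. ?f x l) \<in> O[F](\<lambda>x. 1)" by (rule bigoI)
    then show ?thesis using 1 by simp
  next
    case 2
    have "eventually (\<lambda>x. norm (- 1 / real (r * n x)) \<le> 1 * norm (1 / real (n x) ^ 1)) F"
      using n1 by eventually_elim (use r in \<open>auto simp: divide_simps\<close>)
    then have "(\<lambda>x. - 1 / real (r * n x)) \<in> O[F](\<lambda>x. 1 / real (n x) ^ 1)" by (rule bigoI)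
    moreover have "(fwd_diff ^^ j) (?f x) l = - 1 / real (r * n x)" for x
      unfolding 2 One_nat_def funpow.simps o_id d by (rule refl)
    ultimately show ?thesis unfolding 2 by (simp only: One_nat_def)
  next
    case 3
    have "(fwd_diff ^^ j) (?f x) l = (fwd_diff ^^ Suc i) (\<lambda>l. - 1 / real (r * n x)) l" for x
      unfolding 3 by (subst funpow_Suc_right) (simp only: o_apply d)
    then show ?thesis by (simp add: fwd_diff_pow_const del: funpow.simps(2))
  qed
qed

text \<open>By Newton's formula differences at \<open>l\<close> are combinations of differences at \<open>0\<close> of the same or
  higher order.\<close>

lemma slowly_varyingI_at_0:
  assumes n: "filterlim n at_top F"
    and 0: "\<And>t. t \<le> m \<Longrightarrow> (\<lambda>x. (fwd_diff ^^ t) (g x) 0) \<in> O[F](\<lambda>x. 1 / real (n x) ^ t)"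
  shows "slowly_varying F n m g"
  unfolding slowly_varying_def
proof (intro allI impI)
  fix j l assume jl: "j + l \<le> m"
  have eq: "(fwd_diff ^^ j) (g x) l = (\<Sum>s\<le>l. real (l choose s) * (fwd_diff ^^ (j + s)) (g x) 0)" for x
    using fwd_diff_pow_shift_newton[of j "g x" 0 l] by simp
  show "(\<lambda>x. (fwd_diff ^^ j) (g x) l) \<in> O[F](\<lambda>x. 1 / real (n x) ^ j)"
    unfolding eq
  proof (rule big_sum_in_bigo)
    fix s assume s: "s \<in> {..l}"
    have "(\<lambda>x. (fwd_diff ^^ (j + s)) (g x) 0) \<in> O[F](\<lambda>x. 1 / real (n x) ^ (j + s))"
      using s jl by (intro 0) auto
    also have "(\<lambda>x. 1 / real (n x) ^ (j + s)) \<in> O[F](\<lambda>x. 1 / real (n x) ^ j)"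
      by (rule bigo_inverse_power_mono[OF n]) simp
    finally show "(\<lambda>x. real (l choose s) * (fwd_diff ^^ (j + s)) (g x) 0) \<in> O[F](\<lambda>x. 1 / real (n x) ^ j)"
      by simp
  qed
qed

text \<open>Division by a factor that tends to 1, where the factor \<open>q t\<close> may depend on the order \<open>t\<close> of the
  difference that is known: in the Leibniz expansion of the difference of order \<open>t\<close> of the product,
  the top difference of \<open>g\<close> comes with the coefficient \<open>q t x t\<close>, and all other
  terms are small by induction.\<close>

lemma slowly_varying_of_mult:
  assumes n: "filterlim n at_top F"
    and q: "\<And>t. t \<ge> 1 \<Longrightarrow> t \<le> m \<Longrightarrow> slowly_varying F n m (q t)"
    and q1: "\<And>t. t \<ge> 1 \<Longrightarrow> t \<le> m \<Longrightarrow> ((\<lambda>x. q t x t) \<longlongrightarrow> 1) F"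
    and g0: "(\<lambda>x. g x 0) \<in> O[F](\<lambda>x. 1)"
    and gq: "\<And>t. t \<ge> 1 \<Longrightarrow> t \<le> m \<Longrightarrow>
      (\<lambda>x. (fwd_diff ^^ t) (\<lambda>l. g x l * q t x l) 0) \<in> O[F](\<lambda>x. 1 / real (n x) ^ t)"
  shows "slowly_varying F n m g"
proof (rule slowly_varyingI_at_0[OF n])
  fix t assume "t \<le> m"
  then show "(\<lambda>x. (fwd_diff ^^ t) (g x) 0) \<in> O[F](\<lambda>x. 1 / real (n x) ^ t)"
  proof (induction t rule: less_induct)
    case (less t)
    show ?case
    proof (cases "t = 0")
      case True
      then show ?thesis using g0 by simp
    next
      case False
      have eq: "(fwd_diff ^^ t) (g x) 0 * q t x t = (fwd_diff ^^ t) (\<lambda>l. g x l * q t x l) 0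
        - (\<Sum>s<t. real (t choose s) * (fwd_diff ^^ s) (g x) 0 * (fwd_diff ^^ (t - s)) (q t x) (0 + s))" for x
        unfolding fwd_diff_pow_mult by (simp flip: lessThan_Suc_atMost)
      have "(\<lambda>x. (fwd_diff ^^ t) (g x) 0 * q t x t) \<in> O[F](\<lambda>x. 1 / real (n x) ^ t)"
        unfolding eq
      proof (intro sum_in_bigo gq big_sum_in_bigo)
        fix s assume s: "s \<in> {..<t}"
        have "(\<lambda>x. (fwd_diff ^^ s) (g x) 0 * (fwd_diff ^^ (t - s)) (q t x) (0 + s))
          \<in> O[F](\<lambda>x. 1 / real (n x) ^ s * (1 / real (n x) ^ (t - s)))"
          using s less.prems False
          by (intro landau_o.big.mult less.IH slowly_varyingD[OF q]) auto
        then show "(\<lambda>x. real (t choose s) * (fwd_diff ^^ s) (g x) 0 * (fwd_diff ^^ (t - s)) (q t x) (0 + s))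
          \<in> O[F](\<lambda>x. 1 / real (n x) ^ t)"
          using s by (simp add: mult.assoc flip: power_add)
      qed (use False less.prems in auto)
      moreover have "(\<lambda>x. (fwd_diff ^^ t) (g x) 0) \<in> O[F](\<lambda>x. (fwd_diff ^^ t) (g x) 0 * q t x t)"
      proof (rule bigoI[where c = 2])
        have "eventually (\<lambda>x. q t x t > 1/2) F"
          using q1[of t] False less.prems by (intro order_tendstoD(1)) auto
        then show "eventually (\<lambda>x. norm ((fwd_diff ^^ t) (g x) 0) \<le> 2 * norm ((fwd_diff ^^ t) (g x) 0 * q t x t)) F"
        proof eventually_elim
          case (elim x)
          have "\<bar>(fwd_diff ^^ t) (g x) 0\<bar> * 1 \<le> \<bar>(fwd_diff ^^ t) (g x) 0\<bar> * (2 * q t x t)"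
            using elim by (intro mult_left_mono) auto
          then show ?case using elim by (simp add: abs_mult mult_ac)
        qed
      qed
      ultimately show ?thesis by (rule landau_o.big_trans[rotated])
    qed
  qed
qed

text \<open>The difference of the two sides has derivative \<open>(-u)\<^sup>k / (1 + u)\<close>.\<close>

lemma ln_one_plus_taylor_bound:
  fixes u :: real
  assumes "\<bar>u\<bar> \<le> 1/2"
  shows "\<bar>ln (1 + u) - (\<Sum>s<k. (-1) ^ s / real (Suc s) * u ^ Suc s)\<bar> \<le> 2 * \<bar>u\<bar> ^ Suc k"
proof -
  let ?f = "\<lambda>u. ln (1 + u) - (\<Sum>s<k. (-1) ^ s / real (Suc s) * u ^ Suc s)"
  let ?f' = "\<lambda>u. (- u) ^ k / (1 + u) :: real"
  have deriv: "(?f has_real_derivative ?f' x) (at x)" if "\<bar>x\<bar> \<le> 1/2" for x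
  proof -
    have "((\<lambda>u. \<Sum>s<k. (-1) ^ s / real (Suc s) * u ^ Suc s) has_real_derivative (\<Sum>s<k. (- x) ^ s)) (at x)"
    proof (rule DERIV_sum)
      fix s
      have "((\<lambda>u. (-1) ^ s / real (Suc s) * u ^ Suc s) has_real_derivative
          (-1) ^ s / real (Suc s) * (real (Suc s) * x ^ s)) (at x)"
        by (rule DERIV_cmult) (use DERIV_pow[of "Suc s" x] in simp)
      also have "(-1) ^ s / real (Suc s) * (real (Suc s) * x ^ s) = (- x) ^ s"
        by (simp add: power_minus[of x])
      finally show "((\<lambda>u. (-1) ^ s / real (Suc s) * u ^ Suc s) has_real_derivative (- x) ^ s) (at x)" .
    qed
    moreover have "((\<lambda>u. ln (1 + u)) has_real_derivative 1 / (1 + x)) (at x)"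
      using that by (auto intro!: derivative_eq_intros)
    ultimately have "(?f has_real_derivative 1 / (1 + x) - (\<Sum>s<k. (- x) ^ s)) (at x)"
      by (rule DERIV_diff[rotated])
    also have "(\<Sum>s<k. (- x) ^ s) = (1 - (- x) ^ k) / (1 + x)"
      using that geometric_sum[of "- x" k] by (simp add: divide_simps) (simp add: algebra_simps)
    also have "1 / (1 + x) - (1 - (- x) ^ k) / (1 + x) = ?f' x"
      by (simp add: diff_divide_distrib)
    finally show ?thesis .
  qed
  have bound: "\<bar>?f' x\<bar> \<le> 2 * \<bar>u\<bar> ^ k" if "\<bar>x\<bar> \<le> \<bar>u\<bar>" for x
  proof -
    have "\<bar>?f' x\<bar> = \<bar>x\<bar> ^ k * (1 / (1 + x))"
      using that assms by (simp add: abs_mult power_abs)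
    also have "\<dots> \<le> \<bar>u\<bar> ^ k * 2"
      using that assms by (intro mult_mono power_mono) (auto simp: divide_simps)
    finally show ?thesis by simp
  qed
  have "norm (?f u - ?f 0) \<le> (2 * \<bar>u\<bar> ^ k) * norm (u - 0)"
  proof (rule field_differentiable_bound[of "cball 0 \<bar>u\<bar>" ?f ?f'])
    fix x :: real assume "x \<in> cball 0 \<bar>u\<bar>"
    then have x: "\<bar>x\<bar> \<le> \<bar>u\<bar>" by simp
    then show "(?f has_field_derivative ?f' x) (at x within cball 0 \<bar>u\<bar>)"
      using deriv[of x] assms by (auto intro: has_field_derivative_at_within)
    show "norm (?f' x) \<le> 2 * \<bar>u\<bar> ^ k" using bound[OF x] by simp
  qed auto
  then show ?thesis by (simp add: mult_ac)
qed

text \<open>As \<open>g = 1 + u\<close> with \<open>u = O(1/n)\<close>, the logarithm is a polynomial in \<open>u\<close>, which is slowly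
  varying, plus an error of size \<open>O(n\<^sup>-\<^sup>k)\<close> at every single argument, whose difference of order \<open>k\<close>
  is of the same size.\<close>

lemma fwd_diff_ln_bigo:
  assumes n: "filterlim n at_top F" and g: "slowly_varying F n m g"
    and g0: "eventually (\<lambda>x. g x 0 = 1) F" and kl: "k + l \<le> m" "k \<ge> 1"
  shows "(\<lambda>x. (fwd_diff ^^ k) (\<lambda>l. ln (g x l)) l) \<in> O[F](\<lambda>x. 1 / real (n x) ^ k)"
    and "eventually (\<lambda>x. g x l > 0) F"
proof -
  obtain k' where k': "k = Suc k'" using kl by (cases k) auto
  \<comment> \<open>The Taylor polynomial of degree \<open>k - 1\<close> suffices, since its error is of order \<open>u\<^sup>k\<close>.\<close>
  define u where "u = (\<lambda>x l. g x l - 1)"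
  have u_small: "(\<lambda>x. u x i) \<in> O[F](\<lambda>x. 1 / real (n x))" if i: "i \<le> m" for i
  proof -
    have eq: "g x i - g x 0 = (\<Sum>s<i. real (i choose Suc s) * (fwd_diff ^^ Suc s) (g x) 0)" for x
    proof -
      have "g x i = (\<Sum>s\<le>i. real (i choose s) * (fwd_diff ^^ s) (g x) 0)"
        using fwd_diff_pow_shift_newton[of 0 "g x" 0 i] by simp
      also have "\<dots> = g x 0 + (\<Sum>s<i. real (i choose Suc s) * (fwd_diff ^^ Suc s) (g x) 0)"
        by (subst sum.lessThan_Suc_shift[unfolded lessThan_Suc_atMost]) (simp del: funpow.simps(2))
      finally show ?thesis by simp
    qed
    have "(\<lambda>x. g x i - g x 0) \<in> O[F](\<lambda>x. 1 / real (n x) ^ 1)"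
      unfolding eq
    proof (rule big_sum_in_bigo)
      fix s assume s: "s \<in> {..<i}"
      have "(\<lambda>x. (fwd_diff ^^ Suc s) (g x) 0) \<in> O[F](\<lambda>x. 1 / real (n x) ^ Suc s)"
        using s i by (intro slowly_varyingD[OF g]) auto
      also have "(\<lambda>x. 1 / real (n x) ^ Suc s) \<in> O[F](\<lambda>x. 1 / real (n x) ^ 1)"
        by (rule bigo_inverse_power_mono[OF n]) simp
      finally show "(\<lambda>x. real (i choose Suc s) * (fwd_diff ^^ Suc s) (g x) 0) \<in> O[F](\<lambda>x. 1 / real (n x) ^ 1)"
        by simp
    qed
    moreover have "eventually (\<lambda>x. g x i - g x 0 = u x i) F"
      using g0 by eventually_elim (simp add: u_def)
    ultimately show ?thesis by (simp add: landau_o.big.in_cong)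
  qed
  have inv0: "((\<lambda>x. 1 / real (n x)) \<longlongrightarrow> 0) F"
    using n filterlim_compose[OF lim_1_over_n] by blast
  have u_half: "eventually (\<lambda>x. \<bar>u x i\<bar> \<le> 1/2) F" if i: "i \<le> m" for i
  proof -
    have "((\<lambda>x. u x i) \<longlongrightarrow> 0) F"
    proof -
      have "(\<lambda>x. 1 / real (n x)) \<in> o[F](\<lambda>x. 1)"
        using inv0 by (intro smalloI_tendsto) auto
      with u_small[OF i] have "(\<lambda>x. u x i) \<in> o[F](\<lambda>x. 1)"
        by (rule landau_o.big_small_trans)
      then show ?thesis using smalloD_tendsto by fastforce
    qed
    then have "eventually (\<lambda>x. dist (u x i) 0 < 1/2) F" by (rule tendstoD) simp
    then show ?thesis by eventually_elim simp
  qed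
  show "eventually (\<lambda>x. g x l > 0) F"
  proof -
    have "l \<le> m" using kl by simp
    from u_half[OF this] show ?thesis
    proof eventually_elim
      case (elim x)
      then show ?case unfolding u_def by linarith
    qed
  qed
  define P where "P = (\<lambda>x i. \<Sum>s<k'. (-1) ^ s / real (Suc s) * u x i ^ Suc s)"
  define e where "e = (\<lambda>x i. ln (g x i) - P x i)"
  have "slowly_varying F n m u"
    using slowly_varying_add[OF g slowly_varying_const[of F n m "-1"]] by (simp add: u_def)
  then have "slowly_varying F n m P"
    unfolding P_def by (intro slowly_varying_sum slowly_varying_cmult slowly_varying_power)
  then have P: "(\<lambda>x. (fwd_diff ^^ k) (P x) l) \<in> O[F](\<lambda>x. 1 / real (n x) ^ k)"
    using kl by (intro slowly_varyingD)
  have e: "(\<lambda>x. e x i) \<in> O[F](\<lambda>x. 1 / real (n x) ^ k)" if i: "i \<le> m" for i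
  proof -
    have "(\<lambda>x. e x i) \<in> O[F](\<lambda>x. u x i ^ k)"
    proof (rule bigoI[where c = 2])
      show "eventually (\<lambda>x. norm (e x i) \<le> 2 * norm (u x i ^ k)) F"
        using u_half[OF i]
        by eventually_elim
          (use ln_one_plus_taylor_bound[of _ k'] in \<open>force simp: e_def P_def k' u_def power_abs abs_mult\<close>)
    qed
    also have "(\<lambda>x. u x i ^ k) \<in> O[F](\<lambda>x. (1 / real (n x)) ^ k)"
      by (rule landau_o.big_power[OF u_small[OF i]])
    finally show ?thesis by (simp add: power_divide)
  qed
  have "(\<lambda>x. (fwd_diff ^^ k) (e x) l) \<in> O[F](\<lambda>x. 1 / real (n x) ^ k)"
    unfolding fwd_diff_pow_binomial_sum
  proof (rule big_sum_in_bigo)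
    fix s assume "s \<in> {..k}"
    then have "(\<lambda>x. e x (l + s)) \<in> O[F](\<lambda>x. 1 / real (n x) ^ k)" using kl by (intro e) auto
    then show "(\<lambda>x. (-1) ^ (k - s) * real (k choose s) * e x (l + s)) \<in> O[F](\<lambda>x. 1 / real (n x) ^ k)"
      by simp
  qed
  with P have "(\<lambda>x. (fwd_diff ^^ k) (P x) l + (fwd_diff ^^ k) (e x) l) \<in> O[F](\<lambda>x. 1 / real (n x) ^ k)"
    by (rule sum_in_bigo)
  then show "(\<lambda>x. (fwd_diff ^^ k) (\<lambda>l. ln (g x l)) l) \<in> O[F](\<lambda>x. 1 / real (n x) ^ k)"
    by (simp flip: fwd_diff_pow_add add: e_def)
qed

section \<open>Moebius inversion and the top kernel of the Johnson scheme\<close>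

abbreviation subsets_of_card :: "'a set \<Rightarrow> nat \<Rightarrow> 'a set set" where
  "subsets_of_card E t \<equiv> {X. X \<subseteq> E \<and> card X = t}"

lemma finite_subsets_of_card: "finite E \<Longrightarrow> finite (subsets_of_card E t)"
  by simp

text \<open>The Moebius transform, over the lattice of subsets, of the indicator of transversality.\<close>

definition inj_mobius :: "('e \<Rightarrow> 'a) \<Rightarrow> 'e set \<Rightarrow> real" where
  "inj_mobius f T = (-1) ^ card T * (\<Sum>S\<in>Pow T. (-1) ^ card S * of_bool (inj_on f S))"

lemma sum_inj_mobius:
  assumes "finite X"
  shows "(\<Sum>T\<in>Pow X. inj_mobius f T) = of_bool (inj_on f X)"
  using inclusion_exclusion_symmetric[of "\<lambda>T. \<Sum>S\<in>Pow T. (-1) ^ card S * of_bool (inj_on f S)"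
      "\<lambda>S. of_bool (inj_on f S) :: real" X] assms
  by (simp add: inj_mobius_def)

text \<open>Adding or removing an element \<open>e\<close> that is alone in its fibre does not affect injectivity, so the
  subsets with and without \<open>e\<close> cancel in pairs.\<close>

lemma inj_mobius_eq_0:
  assumes "finite T" "e \<in> T" and alone: "\<And>e'. e' \<in> T \<Longrightarrow> e' \<noteq> e \<Longrightarrow> f e' \<noteq> f e"
  shows "inj_mobius f T = 0"
proof -
  let ?h = "\<lambda>S. (-1) ^ card S * of_bool (inj_on f S) :: real"
  define U where "U = T - {e}"
  have U: "T = insert e U" "e \<notin> U" "finite U"
    using assms by (auto simp: U_def)
  have "(\<Sum>S\<in>Pow T. ?h S) = (\<Sum>S\<in>Pow U. ?h S) + (\<Sum>S\<in>insert e ` Pow U. ?h S)"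
    unfolding U Pow_insert using U by (intro sum.union_disjoint) auto
  also have "(\<Sum>S\<in>insert e ` Pow U. ?h S) = (\<Sum>S\<in>Pow U. ?h (insert e S))"
    using U(2) by (subst sum.reindex) (auto simp: inj_on_def)
  also have "\<dots> = (\<Sum>S\<in>Pow U. - ?h S)"
  proof (intro sum.cong refl)
    fix S assume S: "S \<in> Pow U"
    have "e \<notin> S" "finite S" using S U by (auto intro: finite_subset)
    moreover have "f e \<notin> f ` S"
      using S U alone by fastforce
    ultimately show "?h (insert e S) = - ?h S" by simp
  qed
  finally show ?thesis by (simp add: inj_mobius_def sum_negf)
qed

lemma abs_inj_mobius_le:
  assumes "finite T"
  shows "\<bar>inj_mobius f T\<bar> \<le> 2 ^ card T"
proof -
  have "\<bar>inj_mobius f T\<bar> = \<bar>\<Sum>S\<in>Pow T. (-1) ^ card S * of_bool (inj_on f S) :: real\<bar>"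
    by (simp add: inj_mobius_def abs_mult)
  also have "\<dots> \<le> (\<Sum>S\<in>Pow T. \<bar>(-1) ^ card S * of_bool (inj_on f S)\<bar>)"
    by (rule sum_abs)
  also have "\<dots> \<le> (\<Sum>S\<in>Pow T. 1)"
    by (intro sum_mono) (auto simp: abs_mult power_abs)
  also have "\<dots> = 2 ^ card T" using assms by (simp add: card_Pow)
  finally show ?thesis .
qed

text \<open>Evaluated at \<open>M = N - t\<close> and \<open>c = |X - Y|\<close> this is, up to a constant factor, the projection onto the
  top eigenspace of the Johnson scheme on the \<open>t\<close>-subsets of an \<open>N\<close>-set.\<close>

definition top_kernel :: "nat \<Rightarrow> nat \<Rightarrow> real" where
  "top_kernel M c = (-1) ^ c / real (M choose c)"

text \<open>There are \<open>c + 1\<close> ways to extend \<open>T\<close> inside \<open>Y\<close>, which keep \<open>c = |T - Y|\<close>, and \<open>M - c\<close> ways to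
  extend it outside \<open>Y\<close>, which increase \<open>c\<close> by one. The two contributions cancel because of
  \<open>(c + 1) binomial(M, c + 1) = (M - c) binomial(M, c)\<close>.\<close>

lemma sum_top_kernel_supersets_insert:
  assumes E: "finite E" and Y: "Y \<subseteq> E" "card Y = Suc s" and N: "2 * Suc s \<le> card E"
    and T: "T \<subseteq> E" "card T = s"
  shows "(\<Sum>e\<in>E - T. top_kernel (card E - Suc s) (card (insert e T - Y))) = 0"
proof -
  define M where "M = card E - Suc s"
  define c where "c = card (T - Y)"
  have fin: "finite Y" "finite T" using E Y T by (auto intro: finite_subset)
  have "c \<le> s" unfolding c_def using T fin by (metis card_mono Diff_subset)
  then have cM: "c < M" using N by (simp add: M_def)
  have card_int: "card (T \<inter> Y) + c = s"
    using T card_Int_Diff[of T Y] fin by (simp add: c_def)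
  have "card (Y - T) = Suc s - card (Y \<inter> T)"
    using Y fin by (simp add: card_Diff_subset_Int)
  then have YT: "card (Y - T) = Suc c" using card_int by (simp add: Int_commute)
  have "card (E - T - Y) = card (E - (T \<union> Y))" by (simp add: Diff_Un Diff_eq ac_simps)
  also have "\<dots> = card E - card (T \<union> Y)" using fin T Y by (intro card_Diff_subset) auto
  also have "card (T \<union> Y) = card Y + c"
  proof -
    have "T \<union> Y = Y \<union> (T - Y)" by auto
    then show ?thesis unfolding c_def using fin by (metis card_Un_disjoint Diff_disjoint finite_Diff)
  qed
  finally have ETY: "card (E - T - Y) = M - c" using Y by (simp add: M_def)
  have "(\<Sum>e\<in>E - T. top_kernel M (card (insert e T - Y)))
      = (\<Sum>e\<in>(Y - T) \<union> (E - T - Y). top_kernel M (card (insert e T - Y)))"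
    by (rule sum.cong) (use Y in auto)
  also have "\<dots> = (\<Sum>e\<in>Y - T. top_kernel M (card (insert e T - Y)))
                + (\<Sum>e\<in>E - T - Y. top_kernel M (card (insert e T - Y)))"
    using E fin by (intro sum.union_disjoint) auto
  also have "(\<Sum>e\<in>Y - T. top_kernel M (card (insert e T - Y))) = (\<Sum>e\<in>Y - T. top_kernel M c)"
    by (intro sum.cong refl) (simp add: c_def)
  also have "(\<Sum>e\<in>E - T - Y. top_kernel M (card (insert e T - Y))) = (\<Sum>e\<in>E - T - Y. top_kernel M (Suc c))"
    by (intro sum.cong refl) (simp add: c_def insert_Diff_if fin)
  also have "(\<Sum>e\<in>Y - T. top_kernel M c) + (\<Sum>e\<in>E - T - Y. top_kernel M (Suc c))
      = real (Suc c) * top_kernel M c + real (M - c) * top_kernel M (Suc c)"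
    using YT ETY by simp
  also have "\<dots> = 0"
  proof -
    have "real (Suc c) * real (M choose Suc c) = real (M - c) * real (M choose c)"
      using binomial_absorb_comp[of M c] binomial_absorption[of c M]
      by (simp only: flip: of_nat_mult)
    then show ?thesis
      using cM by (simp add: top_kernel_def divide_simps del: binomial_Suc_Suc of_nat_Suc)
  qed
  finally show ?thesis by (simp add: M_def)
qed

text \<open>Orthogonality to the lower eigenspaces. Adding elements one at a time reduces the claim to the
  case \<open>|T| = t - 1\<close>, which is the preceding lemma.\<close>

lemma sum_top_kernel_supersets:
  assumes E: "finite E" and Y: "Y \<subseteq> E" "card Y = t" and N: "2 * t \<le> card E"
    and T: "T \<subseteq> E" "card T < t"
  shows "(\<Sum>X | T \<subseteq> X \<and> X \<subseteq> E \<and> card X = t. top_kernel (card E - t) (card (X - Y))) = 0"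
  using T
proof (induction "t - card T" arbitrary: T)
  case (Suc d)
  let ?K = "\<lambda>X. top_kernel (card E - t) (card (X - Y))"
  let ?F = "\<lambda>T. {X. T \<subseteq> X \<and> X \<subseteq> E \<and> card X = t}"
  have finT: "finite T" using Suc.prems E by (auto intro: finite_subset)
  have fF: "finite (?F T)" for T using E by simp
  have inner: "(\<Sum>X\<in>?F (insert e T). ?K X) = (if d = 0 then ?K (insert e T) else 0)" if e: "e \<in> E - T" for e
  proof (cases "d = 0")
    case True
    then have t: "card (insert e T) = t" using Suc e finT by simp
    have "?F (insert e T) = {insert e T}"
    proof (intro set_eqI iffI)
      fix X assume "X \<in> ?F (insert e T)"
      then have "insert e T \<subseteq> X" "X \<subseteq> E" "card X = card (insert e T)" using t by auto
      then have "X = insert e T" using E by (metis card_subset_eq finite_subset)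
      then show "X \<in> {insert e T}" by simp
    qed (use t e Suc.prems in auto)
    then show ?thesis using True by simp
  next
    case False
    have "(\<Sum>X\<in>?F (insert e T). ?K X) = 0"
      by (rule Suc.hyps(1)) (use False Suc e finT in auto)
    then show ?thesis using False by simp
  qed
  \<comment> \<open>Each \<open>X\<close> above \<open>T\<close> lies above \<open>insert e T\<close> for exactly \<open>t - |T|\<close> elements \<open>e\<close>.\<close>
  have "(\<Sum>e\<in>E - T. \<Sum>X\<in>?F (insert e T). ?K X) = 0"
  proof (cases "d = 0")
    case True
    then have t: "t = Suc (card T)" using Suc by simp
    have "(\<Sum>e\<in>E - T. ?K (insert e T)) = 0"
      unfolding t by (rule sum_top_kernel_supersets_insert) (use t Suc.prems Y N E in auto)
    moreover have "(\<Sum>e\<in>E - T. \<Sum>X\<in>?F (insert e T). ?K X) = (\<Sum>e\<in>E - T. ?K (insert e T))"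
      by (intro sum.cong refl) (simp only: inner True if_True simp_thms)
    ultimately show ?thesis by simp
  next
    case False
    then have "\<forall>e\<in>E - T. (\<Sum>X\<in>?F (insert e T). ?K X) = 0"
      using inner by (simp only: if_False) blast
    then show ?thesis by (rule sum.neutral)
  qed
  also have "(\<Sum>e\<in>E - T. \<Sum>X\<in>?F (insert e T). ?K X)
      = (\<Sum>e\<in>E - T. \<Sum>X\<in>{X \<in> ?F T. e \<in> X}. ?K X)"
    by (intro sum.cong) auto
  also have "\<dots> = (\<Sum>X\<in>?F T. \<Sum>e\<in>{e \<in> E - T. e \<in> X}. ?K X)"
    by (rule sum.swap_restrict) (use E in auto)
  also have "\<dots> = (\<Sum>X\<in>?F T. real (t - card T) * ?K X)"
  proof (intro sum.cong refl)
    fix X assume X: "X \<in> ?F T"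
    then have "{e \<in> E - T. e \<in> X} = X - T" by auto
    moreover have "card (X - T) = t - card T" using X finT by (simp add: card_Diff_subset)
    ultimately show "(\<Sum>e\<in>{e \<in> E - T. e \<in> X}. ?K X) = real (t - card T) * ?K X" by simp
  qed
  finally have "real (t - card T) * (\<Sum>X\<in>?F T. ?K X) = 0"
    by (simp add: sum_distrib_left)
  moreover have "real (t - card T) \<noteq> 0" using Suc.prems by simp
  ultimately show ?case by (simp only: mult_eq_0_iff) simp
qed simp

text \<open>Expand the indicator as a sum of Moebius transforms over the subsets \<open>T\<close> of \<open>X\<close>. Proper subsets
  contribute nothing by orthogonality.\<close>

lemma sum_top_kernel_inj:
  assumes E: "finite E" and Y: "Y \<subseteq> E" "card Y = t" and N: "2 * t \<le> card E"
  shows "(\<Sum>X\<in>subsets_of_card E t. of_bool (inj_on f X) * top_kernel (card E - t) (card (X - Y)))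
       = (\<Sum>X\<in>subsets_of_card E t. inj_mobius f X * top_kernel (card E - t) (card (X - Y)))"
proof -
  let ?K = "\<lambda>X. top_kernel (card E - t) (card (X - Y))"
  have fin: "X \<in> subsets_of_card E t \<Longrightarrow> finite X" for X
    using E by (auto intro: finite_subset)
  have "(\<Sum>X\<in>subsets_of_card E t. of_bool (inj_on f X) * ?K X)
      = (\<Sum>X\<in>subsets_of_card E t. \<Sum>T\<in>{T \<in> Pow E. T \<subseteq> X}. inj_mobius f T * ?K X)"
  proof (intro sum.cong refl)
    fix X assume X: "X \<in> subsets_of_card E t"
    then have "{T \<in> Pow E. T \<subseteq> X} = Pow X" by auto
    then show "of_bool (inj_on f X) * ?K X = (\<Sum>T\<in>{T \<in> Pow E. T \<subseteq> X}. inj_mobius f T * ?K X)"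
      using sum_inj_mobius[OF fin[OF X], of f] by (simp flip: sum_distrib_right)
  qed
  also have "\<dots> = (\<Sum>T\<in>Pow E. \<Sum>X\<in>{X \<in> subsets_of_card E t. T \<subseteq> X}. inj_mobius f T * ?K X)"
    by (rule sum.swap_restrict) (use E in auto)
  also have "\<dots> = (\<Sum>T\<in>Pow E. inj_mobius f T * (\<Sum>X | T \<subseteq> X \<and> X \<subseteq> E \<and> card X = t. ?K X))"
    by (simp add: sum_distrib_left conj_ac)
  also have "\<dots> = (\<Sum>T\<in>Pow E. if card T = t then inj_mobius f T * ?K T else 0)"
  proof (intro sum.cong refl)
    fix T assume T: "T \<in> Pow E"
    consider "card T < t" | "card T = t" | "card T > t" by linarith
    then show "inj_mobius f T * (\<Sum>X | T \<subseteq> X \<and> X \<subseteq> E \<and> card X = t. ?K X)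
        = (if card T = t then inj_mobius f T * ?K T else 0)"
    proof cases
      case 1
      then show ?thesis using sum_top_kernel_supersets[OF E Y N, of T] T by simp
    next
      case 2
      have "X = T" if "T \<subseteq> X" "X \<subseteq> E" "card X = t" for X
        using that 2 E by (metis card_subset_eq finite_subset)
      then have "{X. T \<subseteq> X \<and> X \<subseteq> E \<and> card X = t} = {T}"
        using 2 T by auto
      then show ?thesis using 2 by simp
    next
      case 3
      have "{X. T \<subseteq> X \<and> X \<subseteq> E \<and> card X = t} = {}"
        using 3 E by (auto dest: card_mono[OF finite_subset[OF _ E]])
      then show ?thesis using 3 by (simp del: Collect_empty_eq)
    qed
  qed
  also have "\<dots> = (\<Sum>X\<in>subsets_of_card E t. inj_mobius f X * ?K X)"
    using E by (simp flip: sum.inter_filter) 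
  finally show ?thesis .
qed

lemma card_Diff_eq_if_card_eq:
  assumes "finite X" "finite Y" "card X = card Y"
  shows "card (X - Y) = card (Y - X)"
  using card_Int_Diff[of X Y] card_Int_Diff[of Y X] assms by (simp add: Int_commute)

text \<open>The random variable \<open>Z\<^sub>t\<close> of the introduction, for edges \<open>e\<close> with left endpoint \<open>f e\<close> and right
  endpoint \<open>g e\<close>.\<close>

definition mobius_pair_sum :: "('e \<Rightarrow> 'a) \<Rightarrow> ('e \<Rightarrow> 'b) \<Rightarrow> nat \<Rightarrow> 'e set \<Rightarrow> real" where
  "mobius_pair_sum f g t E = (\<Sum>T\<in>subsets_of_card E t. \<Sum>T'\<in>subsets_of_card E t.
     inj_mobius f T * inj_mobius g T' * top_kernel (card E - t) (card (T - T')))"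

lemma sum_top_kernel_inj_inj:
  assumes E: "finite E" and N: "2 * t \<le> card E"
  shows "(\<Sum>X\<in>subsets_of_card E t. \<Sum>Y\<in>subsets_of_card E t.
            of_bool (inj_on f X) * of_bool (inj_on g Y) * top_kernel (card E - t) (card (X - Y)))
       = mobius_pair_sum f g t E"
proof -
  let ?K = "\<lambda>X Y. top_kernel (card E - t) (card (X - Y))"
  let ?S = "subsets_of_card E t"
  have sym: "?K X Y = ?K Y X" if "X \<in> ?S" "Y \<in> ?S" for X Y
  proof -
    have "finite X" "finite Y" "card X = card Y" using that E by (auto intro: finite_subset)
    then show ?thesis by (simp add: card_Diff_eq_if_card_eq)
  qed
  have "(\<Sum>X\<in>?S. \<Sum>Y\<in>?S. of_bool (inj_on f X) * of_bool (inj_on g Y) * ?K X Y)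
      = (\<Sum>Y\<in>?S. of_bool (inj_on g Y) * (\<Sum>X\<in>?S. of_bool (inj_on f X) * ?K X Y))"
    by (subst sum.swap) (simp add: sum_distrib_left mult_ac)
  also have "\<dots> = (\<Sum>Y\<in>?S. of_bool (inj_on g Y) * (\<Sum>X\<in>?S. inj_mobius f X * ?K X Y))"
    by (intro sum.cong refl arg_cong2[of _ _ _ _ "(*)"] sum_top_kernel_inj) (use E N in auto)
  also have "\<dots> = (\<Sum>X\<in>?S. inj_mobius f X * (\<Sum>Y\<in>?S. of_bool (inj_on g Y) * ?K Y X))"
    unfolding sum_distrib_left by (subst sum.swap, intro sum.cong refl) (simp add: sym mult_ac)
  also have "\<dots> = (\<Sum>X\<in>?S. inj_mobius f X * (\<Sum>Y\<in>?S. inj_mobius g Y * ?K Y X))"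
    by (intro sum.cong refl arg_cong2[of _ _ _ _ "(*)"] sum_top_kernel_inj) (use E N in auto)
  also have "\<dots> = mobius_pair_sum f g t E"
    unfolding mobius_pair_sum_def sum_distrib_left by (intro sum.cong refl) (simp add: sym mult_ac)
  finally show ?thesis .
qed

text \<open>The Newton coefficients of the kernel as a function of \<open>|X \<inter> Y| = t - c\<close>.\<close>

definition top_kernel_coeff :: "nat \<Rightarrow> nat \<Rightarrow> nat \<Rightarrow> real" where
  "top_kernel_coeff N t l = (-1) ^ (t - l) * real (N - t + 1) * fact (t - l) * fact (N - 2 * t) / fact (N - t - l + 1)"

text \<open>By the beta integral the kernel is
  \<open>(N - t + 1)\<close> times the integral over \<open>[0,1]\<close> of \<open>(-s)\<^sup>t\<^sup>-\<^sup>x (1 - s)\<^sup>N\<^sup>-\<^sup>2\<^sup>t\<^sup>+\<^sup>x\<close>, and a difference in \<open>x\<close>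
  multiplies the integrand by \<open>-1/s\<close>. This explains the closed form, which is then verified by
  induction.\<close>

lemma fwd_diff_pow_top_kernel:
  assumes N: "2 * t \<le> N"
  shows "x + j \<le> t \<Longrightarrow> (fwd_diff ^^ j) (\<lambda>x. top_kernel (N - t) (t - x)) x
    = (-1) ^ (t - x - j) * real (N - t + 1) * fact (t - x - j) * fact (N - 2 * t + x) / fact (N - t - j + 1)"
proof (induction j arbitrary: x)
  case 0
  have "t - x \<le> N - t" "N - t - (t - x) = N - 2 * t + x" using N 0 by auto
  then have "real ((N - t) choose (t - x)) = fact (N - t) / (fact (t - x) * fact (N - 2 * t + x))"
    using binomial_fact[of "t - x" "N - t", where ?'a = real] by (simp only:)
  then show ?case
    by (simp add: top_kernel_def mult_ac)
next
  case (Suc j)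
  define a where "a = t - x - Suc j"
  define b where "b = N - 2 * t + x"
  have e: "t - x - j = Suc a" "t - Suc x - j = a" "N - 2 * t + Suc x = Suc b"
      "N - t - j = a + b + 1" "N - t - Suc j + 1 = a + b + 1" "t - x - Suc j = a"
    using N Suc.prems unfolding a_def b_def by linarith+
  define C where "C = (-1) ^ a * real (N - t + 1)"
  have "(fwd_diff ^^ Suc j) (\<lambda>x. top_kernel (N - t) (t - x)) x
      = C * fact a * fact (Suc b) / fact (a + b + 2) + C * fact (Suc a) * fact b / fact (a + b + 2)"
  proof -
    have "(fwd_diff ^^ j) (\<lambda>x. top_kernel (N - t) (t - x)) x = - (C * fact (Suc a) * fact b / fact (a + b + 2))"
    proof -
      have "x + j \<le> t" using Suc.prems by simp
      then show ?thesis
        unfolding Suc.IH[OF \<open>x + j \<le> t\<close>] e C_def b_def[symmetric] by (simp del: fact_Suc)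
    qed
    moreover have "(fwd_diff ^^ j) (\<lambda>x. top_kernel (N - t) (t - x)) (Suc x) = C * fact a * fact (Suc b) / fact (a + b + 2)"
    proof -
      have "Suc x + j \<le> t" using Suc.prems by simp
      then show ?thesis
        unfolding Suc.IH[OF \<open>Suc x + j \<le> t\<close>] e C_def by (simp del: fact_Suc)
    qed
    ultimately show ?thesis unfolding fwd_diff_pow_Suc by simp
  qed
  also have "\<dots> = C * fact a * fact b * (real (a + b + 2)) / fact (a + b + 2)"
    unfolding add_divide_distrib[symmetric] by (simp add: algebra_simps)
  also have "\<dots> = C * fact a * fact b / fact (a + b + 1)"
  proof -
    have "(fact (a + b + 2) :: real) = real (a + b + 2) * fact (a + b + 1)"
      by (simp add: fact_Suc)
    then show ?thesis by (simp del: fact_Suc add: divide_simps)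
  qed
  finally show ?case
    unfolding e C_def b_def[symmetric] .
qed

lemma top_kernel_newton:
  assumes N: "2 * t \<le> N" and x: "x \<le> t"
  shows "top_kernel (N - t) (t - x) = (\<Sum>l\<le>t. top_kernel_coeff N t l * real (x choose l))"
proof -
  have "top_kernel (N - t) (t - x)
      = (\<Sum>l\<le>x. real (x choose l) * (fwd_diff ^^ l) (\<lambda>x. top_kernel (N - t) (t - x)) 0)"
    using fwd_diff_pow_shift_newton[of 0 "\<lambda>x. top_kernel (N - t) (t - x)" 0 x] by simp
  also have "\<dots> = (\<Sum>l\<le>x. top_kernel_coeff N t l * real (x choose l))"
    using x by (intro sum.cong refl) (simp add: fwd_diff_pow_top_kernel[OF N] top_kernel_coeff_def)
  also have "\<dots> = (\<Sum>l\<le>t. top_kernel_coeff N t l * real (x choose l))"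
    using x by (intro sum.mono_neutral_left) (auto simp: binomial_eq_0)
  finally show ?thesis .
qed

section \<open>Common transversals of two partitions\<close>

text \<open>Double counting of the pairs of a transversal with one more element and the element that is
  removed from it.\<close>

lemma card_inj_supersets:
  assumes E: "finite E" and A: "finite A" "f ` E \<subseteq> A"
    and fibres: "\<And>x. x \<in> A \<Longrightarrow> card {e \<in> E. f e = x} = r"
    and S: "S \<subseteq> E" "inj_on f S"
  shows "card {X. S \<subseteq> X \<and> X \<subseteq> E \<and> card X = card S + s \<and> inj_on f X}
       = ((card A - card S) choose s) * r ^ s"
proof (induction s)
  case 0
  have "X = S" if "S \<subseteq> X" "X \<subseteq> E" "card X = card S" for X
    using that E by (metis card_subset_eq finite_subset)
  then have "{X. S \<subseteq> X \<and> X \<subseteq> E \<and> card X = card S + 0 \<and> inj_on f X} = {S}"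
    using S by auto
  then show ?case by simp
next
  case (Suc s)
  let ?F = "\<lambda>s. {X. S \<subseteq> X \<and> X \<subseteq> E \<and> card X = card S + s \<and> inj_on f X}"
  let ?P = "SIGMA X:?F (Suc s). X - S" and ?Q = "SIGMA X:?F s. {e \<in> E. f e \<notin> f ` X}"
  have fin: "finite X" if "X \<subseteq> E" for X using that E by (rule finite_subset)
  have finF: "finite (?F s)" for s using E by simp
  have "bij_betw (\<lambda>(X, e). (X - {e}, e)) ?P ?Q"
  proof (rule bij_betwI[where g = "\<lambda>(X, e). (insert e X, e)"])
    show "(\<lambda>(X, e). (X - {e}, e)) \<in> ?P \<rightarrow> ?Q"
    proof
      fix p assume "p \<in> ?P"
      then obtain X e where p: "p = (X, e)" and X: "S \<subseteq> X" "X \<subseteq> E" "card X = card S + Suc s" "inj_on f X"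
        and e: "e \<in> X" "e \<notin> S" by auto
      have "card (X - {e}) = card S + s" using X e by simp
      moreover have "inj_on f (X - {e})" using X(4) by (rule inj_on_subset) blast
      moreover have "f e \<notin> f ` (X - {e})" using X(4) e(1) by (auto dest: inj_onD)
      moreover have "S \<subseteq> X - {e}" "X - {e} \<subseteq> E" "e \<in> E" using X e by auto
      ultimately show "(case p of (X, e) \<Rightarrow> (X - {e}, e)) \<in> ?Q" by (simp add: p)
    qed
    show "(\<lambda>(X, e). (insert e X, e)) \<in> ?Q \<rightarrow> ?P"
    proof
      fix p assume "p \<in> ?Q"
      then obtain X e where p: "p = (X, e)" and X: "S \<subseteq> X" "X \<subseteq> E" "card X = card S + s" "inj_on f X"
        and e: "e \<in> E" "f e \<notin> f ` X" by auto
      have "e \<notin> X" using e by auto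
      then have "card (insert e X) = card S + Suc s" using X fin by simp
      moreover have "inj_on f (insert e X)" using X e by auto
      moreover have "S \<subseteq> insert e X" "insert e X \<subseteq> E" "e \<notin> S" using X e \<open>e \<notin> X\<close> by auto
      ultimately show "(case p of (X, e) \<Rightarrow> (insert e X, e)) \<in> ?P" by (simp add: p)
    qed
    show "(case (case p of (X, e) \<Rightarrow> (X - {e}, e)) of (X, e) \<Rightarrow> (insert e X, e)) = p" if "p \<in> ?P" for p
      using that by (auto simp: insert_absorb)
    show "(case (case p of (X, e) \<Rightarrow> (insert e X, e)) of (X, e) \<Rightarrow> (X - {e}, e)) = p" if "p \<in> ?Q" for p
      using that by auto
  qed
  then have "card ?P = card ?Q" by (rule bij_betw_same_card)
  also have "card ?P = (\<Sum>X\<in>?F (Suc s). card (X - S))"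
    using finF fin by (intro card_SigmaI) auto
  also have "\<dots> = (\<Sum>X\<in>?F (Suc s). Suc s)"
    using S fin by (intro sum.cong refl) (auto simp: card_Diff_subset)
  also have "card ?Q = (\<Sum>X\<in>?F s. card {e \<in> E. f e \<notin> f ` X})"
    using finF E by (intro card_SigmaI) auto
  also have "\<dots> = (\<Sum>X\<in>?F s. (card A - card S - s) * r)"
  proof (intro sum.cong refl)
    fix X assume X: "X \<in> ?F s"
    have "{e \<in> E. f e \<notin> f ` X} = (\<Union>x\<in>A - f ` X. {e \<in> E. f e = x})"
      using A by auto
    also have "card \<dots> = (\<Sum>x\<in>A - f ` X. card {e \<in> E. f e = x})"
      using A E by (intro card_UN_disjoint) auto
    also have "\<dots> = card (A - f ` X) * r" by (simp add: fibres)
    also have "card (A - f ` X) = card A - card (f ` X)"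
    proof (rule card_Diff_subset)
      show "f ` X \<subseteq> A" using X A by blast
    qed (use X fin in auto)
    also have "card (f ` X) = card S + s" using X by (simp add: card_image)
    finally show "card {e \<in> E. f e \<notin> f ` X} = (card A - card S - s) * r" by simp
  qed
  finally have "Suc s * card (?F (Suc s)) = ((card A - card S) choose s) * r ^ s * ((card A - card S - s) * r)"
    by (simp only: sum_constant Suc.IH mult.commute of_nat_id)
  also have "\<dots> = Suc s * (((card A - card S) choose Suc s) * r ^ Suc s)"
  proof -
    have "((card A - card S) choose s) * (card A - card S - s) = Suc s * ((card A - card S) choose Suc s)"
      using binomial_absorb_comp[of "card A - card S" s] binomial_absorption[of s "card A - card S"]
      by (simp only: mult.commute)
    then show ?thesis by (simp only: mult_ac power_Suc)
  qed
  finally show ?case by (simp only: mult_cancel1 nat.simps) simp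
qed

definition num_common_transversals :: "('e \<Rightarrow> 'a) \<Rightarrow> ('e \<Rightarrow> 'b) \<Rightarrow> 'e set \<Rightarrow> nat \<Rightarrow> nat" where
  "num_common_transversals f g E l = card {S. S \<subseteq> E \<and> card S = l \<and> inj_on f S \<and> inj_on g S}"

text \<open>The binomial coefficient counts the \<open>l\<close>-sets \<open>S\<close> below both \<open>X\<close> and \<open>Y\<close>. Such an \<open>S\<close> is a common
  transversal, and its extensions to \<open>X\<close> and to \<open>Y\<close> are chosen independently.\<close>

lemma sum_binomial_Int_inj_inj:
  assumes E: "finite E" and A: "finite A" "f ` E \<subseteq> A" and B: "finite B" "g ` E \<subseteq> B" "card B = card A"
    and fibres: "\<And>x. x \<in> A \<Longrightarrow> card {e \<in> E. f e = x} = r" "\<And>x. x \<in> B \<Longrightarrow> card {e \<in> E. g e = x} = r"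
    and l: "l \<le> t"
  shows "(\<Sum>X\<in>subsets_of_card E t. \<Sum>Y\<in>subsets_of_card E t.
            of_bool (inj_on f X) * of_bool (inj_on g Y) * real (card (X \<inter> Y) choose l))
       = real (num_common_transversals f g E l) * (real ((card A - l) choose (t - l)) * real r ^ (t - l))\<^sup>2"
proof -
  let ?S = "subsets_of_card E"
  let ?c = "real ((card A - l) choose (t - l)) * real r ^ (t - l)"
  have fin: "finite X" if "X \<subseteq> E" for X using that E by (rule finite_subset)
  have count: "(\<Sum>X\<in>?S t. of_bool (inj_on h X) * of_bool (S \<subseteq> X)) = of_bool (inj_on h S) * ?c"
    if S: "S \<in> ?S l" and h: "h ` E \<subseteq> D" "finite D" "card D = card A"
      "\<And>x. x \<in> D \<Longrightarrow> card {e \<in> E. h e = x} = r" for h :: "_ \<Rightarrow> 'x" and S D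
  proof -
    have "(\<Sum>X\<in>?S t. of_bool (inj_on h X) * of_bool (S \<subseteq> X))
        = (\<Sum>X\<in>?S t. of_bool (inj_on h X \<and> S \<subseteq> X) :: real)"
      by (simp only: of_bool_conj)
    also have "\<dots> = real (card (?S t \<inter> {X. inj_on h X \<and> S \<subseteq> X}))"
      by (intro sum_of_bool_eq finite_subsets_of_card E)
    also have "?S t \<inter> {X. inj_on h X \<and> S \<subseteq> X} = {X \<in> ?S t. inj_on h X \<and> S \<subseteq> X}"
      by blast
    also have "{X \<in> ?S t. inj_on h X \<and> S \<subseteq> X} = {X. S \<subseteq> X \<and> X \<subseteq> E \<and> card X = card S + (t - l) \<and> inj_on h X}"
      using S l by auto
    also have "real (card \<dots>) = of_bool (inj_on h S) * ?c"
    proof (cases "inj_on h S")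
      case True
      then show ?thesis
        using card_inj_supersets[OF E h(2,1,4), of S "t - l"] S h(3) by simp
    next
      case False
      then have "{X. S \<subseteq> X \<and> X \<subseteq> E \<and> card X = card S + (t - l) \<and> inj_on h X} = {}"
        by (auto dest: inj_on_subset)
      then show ?thesis using False by (simp del: Collect_empty_eq)
    qed
    finally show ?thesis .
  qed
  have bin: "real (card (X \<inter> Y) choose l) = (\<Sum>S\<in>?S l. of_bool (S \<subseteq> X) * of_bool (S \<subseteq> Y))"
    if "X \<in> ?S t" "Y \<in> ?S t" for X Y
  proof -
    have "(card (X \<inter> Y) choose l) = card {S. S \<subseteq> X \<inter> Y \<and> card S = l}"
      using that fin by (subst n_subsets) auto
    also have "{S. S \<subseteq> X \<inter> Y \<and> card S = l} = ?S l \<inter> {S. S \<subseteq> X \<and> S \<subseteq> Y}"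
      using that by auto
    also have "real (card \<dots>) = (\<Sum>S\<in>?S l. of_bool (S \<subseteq> X \<and> S \<subseteq> Y))"
      by (intro sum_of_bool_eq[symmetric] finite_subsets_of_card E)
    finally show ?thesis by (simp only: of_bool_conj)
  qed
  have "(\<Sum>X\<in>?S t. \<Sum>Y\<in>?S t. of_bool (inj_on f X) * of_bool (inj_on g Y) * real (card (X \<inter> Y) choose l))
      = (\<Sum>X\<in>?S t. \<Sum>Y\<in>?S t. \<Sum>S\<in>?S l.
          of_bool (inj_on f X) * of_bool (S \<subseteq> X) * (of_bool (inj_on g Y) * of_bool (S \<subseteq> Y)))"
    by (intro sum.cong refl) (simp only: bin sum_distrib_left mult_ac)
  also have "\<dots> = (\<Sum>S\<in>?S l. (\<Sum>X\<in>?S t. of_bool (inj_on f X) * of_bool (S \<subseteq> X))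
      * (\<Sum>Y\<in>?S t. of_bool (inj_on g Y) * of_bool (S \<subseteq> Y)))"
    unfolding sum_product by (subst (2) sum.swap, subst sum.swap, intro sum.cong refl sum.swap)
  also have "\<dots> = (\<Sum>S\<in>?S l. (of_bool (inj_on f S) * ?c) * (of_bool (inj_on g S) * ?c))"
    using A B fibres by (intro sum.cong refl arg_cong2[of _ _ _ _ "(*)"] count) auto
  also have "\<dots> = (\<Sum>S\<in>?S l. of_bool (inj_on f S \<and> inj_on g S) * ?c\<^sup>2)"
    by (intro sum.cong refl) (simp add: power2_eq_square)
  also have "\<dots> = (\<Sum>S\<in>?S l. of_bool (inj_on f S \<and> inj_on g S)) * ?c\<^sup>2"
    by (simp only: sum_distrib_right)
  also have "(\<Sum>S\<in>?S l. of_bool (inj_on f S \<and> inj_on g S) :: real)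
      = real (card (?S l \<inter> {S. inj_on f S \<and> inj_on g S}))"
    by (intro sum_of_bool_eq finite_subsets_of_card E)
  also have "?S l \<inter> {S. inj_on f S \<and> inj_on g S} = {S. S \<subseteq> E \<and> card S = l \<and> inj_on f S \<and> inj_on g S}"
    by blast
  also have "real (card \<dots>) = real (num_common_transversals f g E l)"
    by (simp only: num_common_transversals_def)
  finally show ?thesis .
qed

text \<open>Both sides evaluate the pairing of the two indicators of transversality with the kernel: the left
  one by Newton expansion in \<open>|X \<inter> Y|\<close>, the right one by orthogonality.\<close>

theorem common_transversals_mobius_identity:
  assumes E: "finite E" and A: "finite A" "f ` E \<subseteq> A" and B: "finite B" "g ` E \<subseteq> B" "card B = card A"
    and fibres: "\<And>x. x \<in> A \<Longrightarrow> card {e \<in> E. f e = x} = r" "\<And>x. x \<in> B \<Longrightarrow> card {e \<in> E. g e = x} = r"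
    and N: "2 * t \<le> card E"
  shows "(\<Sum>l\<le>t. top_kernel_coeff (card E) t l * real (num_common_transversals f g E l)
            * (real ((card A - l) choose (t - l)) * real r ^ (t - l))\<^sup>2)
       = mobius_pair_sum f g t E"
proof -
  let ?S = "subsets_of_card E t"
  have "mobius_pair_sum f g t E = (\<Sum>X\<in>?S. \<Sum>Y\<in>?S.
      of_bool (inj_on f X) * of_bool (inj_on g Y) * top_kernel (card E - t) (card (X - Y)))"
    using sum_top_kernel_inj_inj[OF E N, of f g] by simp
  also have "\<dots> = (\<Sum>X\<in>?S. \<Sum>Y\<in>?S. \<Sum>l\<le>t. top_kernel_coeff (card E) t l *
      (of_bool (inj_on f X) * of_bool (inj_on g Y) * real (card (X \<inter> Y) choose l)))"
  proof (intro sum.cong refl)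
    fix X Y assume XY: "X \<in> ?S" "Y \<in> ?S"
    have "finite X" using XY E by (auto intro: finite_subset)
    then have "card (X \<inter> Y) + card (X - Y) = t" using XY card_Int_Diff[of X Y] by simp
    then have "card (X - Y) = t - card (X \<inter> Y)" "card (X \<inter> Y) \<le> t" by auto
    then show "of_bool (inj_on f X) * of_bool (inj_on g Y) * top_kernel (card E - t) (card (X - Y))
      = (\<Sum>l\<le>t. top_kernel_coeff (card E) t l *
      (of_bool (inj_on f X) * of_bool (inj_on g Y) * real (card (X \<inter> Y) choose l)))"
      by (simp add: top_kernel_newton[OF N] sum_distrib_left mult_ac)
  qed
  also have "\<dots> = (\<Sum>l\<le>t. top_kernel_coeff (card E) t l * (\<Sum>X\<in>?S. \<Sum>Y\<in>?S.
      of_bool (inj_on f X) * of_bool (inj_on g Y) * real (card (X \<inter> Y) choose l)))"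
    unfolding sum_distrib_left by (subst (2) sum.swap, subst sum.swap) (rule refl)
  also have "\<dots> = (\<Sum>l\<le>t. top_kernel_coeff (card E) t l * real (num_common_transversals f g E l)
            * (real ((card A - l) choose (t - l)) * real r ^ (t - l))\<^sup>2)"
    by (intro sum.cong refl) (simp add: sum_binomial_Int_inj_inj[OF E A B fibres])
  finally show ?thesis by simp
qed

section \<open>Differences of the transversal ratio\<close>

lemma fact_eq_falling_prod:
  assumes "k \<le> N" "N > 0"
  shows "(fact N :: real) = fact (N - k) * (\<Prod>s<k. real N - real s)"
  using assms(1)
proof (induction k)
  case (Suc k)
  then have "(fact (N - k) :: real) = (real N - real k) * fact (N - Suc k)"
    by (simp add: fact_reduce of_nat_diff Suc_diff_Suc)
  then show ?case using Suc by (simp add: mult_ac)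
qed simp

lemma fact_ratio_eq_power_times_prod:
  assumes "t \<ge> 1" "t + l \<le> N"
  shows "(fact (N - l) :: real)
     = fact (N - t - l + 1) * (real N ^ (t - 1) * (\<Prod>s<t - 1. 1 - real (l + s) / real N))"
proof -
  have "(fact (N - l) :: real) = fact (N - l - (t - 1)) * (\<Prod>s<t - 1. real (N - l) - real s)"
    using assms by (intro fact_eq_falling_prod) auto
  also have "N - l - (t - 1) = N - t - l + 1"
    using assms by linarith
  also have "(\<Prod>s<t - 1. real (N - l) - real s) = (\<Prod>s<t - 1. real N * (1 - real (l + s) / real N))"
    using assms by (intro prod.cong refl) (simp add: of_nat_diff field_simps)
  finally show ?thesis by (simp add: prod.distrib)
qed

text \<open>The quantity \<open>R\<^sub>l\<close> of the introduction, as a function of the sequence \<open>m\<close> of matching numbers.\<close>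

definition transversal_ratio :: "nat \<Rightarrow> nat \<Rightarrow> (nat \<Rightarrow> nat) \<Rightarrow> nat \<Rightarrow> real" where
  "transversal_ratio r n m l = real (m l) * real ((r * n) choose l) / (real (n choose l) * real r ^ l)\<^sup>2"

definition top_kernel_weight :: "nat \<Rightarrow> nat \<Rightarrow> nat \<Rightarrow> real" where
  "top_kernel_weight r n t = fact (r * n) / ((real (n choose t) * real r ^ t)\<^sup>2
      * real (r * n - t + 1) * fact (r * n - 2 * t) * fact t * real (r * n) ^ (t - 1))"

text \<open>The factorials collapse because \<open>(N - l)! / (N - t - l + 1)!\<close> is a polynomial in \<open>l\<close> of degree
  \<open>t - 1\<close>; the product below is this polynomial divided by \<open>N\<^sup>t\<^sup>-\<^sup>1\<close>.\<close>

lemma fwd_diff_transversal_ratio_term: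
  assumes r: "r \<ge> 1" and t: "t \<ge> 1" "2 * t \<le> n" and l: "l \<le> t"
  shows "(-1) ^ (t - l) * real (t choose l) *
       (transversal_ratio r n m l * (\<Prod>s<t - 1. 1 - real (l + s) / real (r * n)))
     = top_kernel_weight r n t * (top_kernel_coeff (r * n) t l * real (m l)
         * (real ((n - l) choose (t - l)) * real r ^ (t - l))\<^sup>2)"
proof -
  define N where "N = r * n"
  have "n \<le> N" using r by (simp add: N_def)
  then have N: "2 * t \<le> N" "N > 0" using t by auto
  define b p c X q :: real where "b = real (n choose l)" and "p = real (n choose t)"
    and "c = real (t choose l)" and "X = real ((n - l) choose (t - l))"
    and "q = (\<Prod>s<t - 1. 1 - real (l + s) / real N)"
  define h :: real where "h = fact (N - t - l + 1)"
  define \<sigma> :: real where "\<sigma> = (-1) ^ (t - l)"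
  have pos: "b > 0" "p > 0" "h > 0" "real r > 0" "real N > 0"
    using t l r N by (auto simp: b_def p_def h_def zero_less_binomial_iff)
  have "(n choose t) * (t choose l) = (n choose l) * ((n - l) choose (t - l))"
    using t l by (intro choose_mult) auto
  then have X: "X = p * c / b"
    using pos unfolding b_def p_def c_def X_def by (simp add: field_simps flip: of_nat_mult)
  have c: "c = fact t / (fact l * fact (t - l))"
    using l by (simp add: c_def binomial_fact)
  have NL: "real (N choose l) = fact N / (fact l * (h * (real N ^ (t - 1) * q)))"
  proof -
    have "(fact (N - l) :: real) = h * (real N ^ (t - 1) * q)"
      unfolding h_def q_def using t l N by (intro fact_ratio_eq_power_times_prod) auto
    then show ?thesis using l N by (simp add: binomial_fact)
  qed
  have q0: "q \<noteq> 0"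
  proof -
    have "1 - real (l + s) / real N \<noteq> 0" if "s < t - 1" for s
      using that l N by (simp add: field_simps flip: of_nat_add)
    then show ?thesis unfolding q_def prod_zero_iff[OF finite_lessThan] by blast
  qed
  have rpow: "real r ^ t = real r ^ l * real r ^ (t - l)"
    using l by (simp flip: power_add)
  have "\<sigma> * c * (real (m l) * real (N choose l) / (b * real r ^ l)\<^sup>2 * q)
      = \<sigma> * c * real (m l) * fact N / (fact l * h * real N ^ (t - 1) * (b * real r ^ l)\<^sup>2)"
    unfolding NL using q0 by (simp add: field_simps)
  also have "\<dots> = fact N / ((p * real r ^ t)\<^sup>2 * real (N - t + 1) * fact (N - 2 * t) * fact t * real N ^ (t - 1))
      * (\<sigma> * real (N - t + 1) * fact (t - l) * fact (N - 2 * t) / h * real (m l) * (X * real r ^ (t - l))\<^sup>2)"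
    unfolding X rpow using pos by (simp add: c power2_eq_square divide_simps)
  finally show ?thesis
    unfolding transversal_ratio_def top_kernel_weight_def top_kernel_coeff_def N_def[symmetric]
      b_def[symmetric] p_def[symmetric] c_def[symmetric] X_def[symmetric] q_def[symmetric]
      h_def[symmetric] \<sigma>_def[symmetric] .
qed

lemma fwd_diff_transversal_ratio:
  assumes E: "finite E" and A: "finite A" "f ` E \<subseteq> A" "card A = n" and B: "finite B" "g ` E \<subseteq> B" "card B = n"
    and fibres: "\<And>x. x \<in> A \<Longrightarrow> card {e \<in> E. f e = x} = r" "\<And>x. x \<in> B \<Longrightarrow> card {e \<in> E. g e = x} = r"
    and r: "r \<ge> 1" and cE: "card E = r * n" and t: "t \<ge> 1" "2 * t \<le> n"
  shows "(fwd_diff ^^ t) (\<lambda>l. transversal_ratio r n (num_common_transversals f g E) l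
              * (\<Prod>s<t - 1. 1 - real (l + s) / real (r * n))) 0
       = top_kernel_weight r n t * mobius_pair_sum f g t E"
proof -
  have "n \<le> r * n" using r by simp
  then have N: "2 * t \<le> card E" using t cE by linarith
  have cAB: "card B = card A" using A B by simp
  have Z: "mobius_pair_sum f g t E = (\<Sum>l\<le>t. top_kernel_coeff (r * n) t l
      * real (num_common_transversals f g E l) * (real ((n - l) choose (t - l)) * real r ^ (t - l))\<^sup>2)"
    using common_transversals_mobius_identity[OF E A(1,2) B(1,2) cAB fibres N] unfolding A(3) cE by simp
  show ?thesis
    unfolding fwd_diff_pow_binomial_sum Z sum_distrib_left add_0
    by (intro sum.cong refl fwd_diff_transversal_ratio_term) (use r t in auto)
qed

lemma top_kernel_weight_le:
  assumes r: "r \<ge> 1" and t: "t \<ge> 1" "2 * t \<le> n"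
  shows "0 \<le> top_kernel_weight r n t" "top_kernel_weight r n t \<le> 2 * real t ^ (2 * t) / real n ^ t"
proof -
  show "0 \<le> top_kernel_weight r n t" by (simp add: top_kernel_weight_def)
  define N where "N = r * n"
  have "n \<le> N" using r by (simp add: N_def)
  then have N: "2 * t \<le> N" "N > 0" using t by auto
  have n0: "n > 0" using t by auto
  have ff: "(fact N :: real) \<le> fact (N - 2 * t) * real N ^ (2 * t)"
  proof -
    have "(\<Prod>s<2 * t. real N - real s) \<le> (\<Prod>s<2 * t. real N)"
      using N by (intro prod_mono) auto
    then show ?thesis
      unfolding fact_eq_falling_prod[OF N] by (intro mult_left_mono) auto
  qed
  have half: "real N / 2 \<le> real (N - t + 1)" using N by (simp add: of_nat_diff)
  have bin: "(real n / real t) ^ t \<le> real (n choose t)"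
    using t binomial_ge_n_over_k_pow_k[of t n, where ?'a = real] by simp
  have "top_kernel_weight r n t \<le> fact (N - 2 * t) * real N ^ (2 * t) /
     ((((real n / real t) ^ t) * real r ^ t)\<^sup>2 * (real N / 2) * fact (N - 2 * t) * 1 * real N ^ (t - 1))"
    unfolding top_kernel_weight_def N_def[symmetric]
    using ff half bin N n0 r t
    by (intro frac_le mult_mono power_mono mult_pos_pos mult_nonneg_nonneg) auto
  also have "\<dots> = 2 * real N ^ (2 * t) * real t ^ (2 * t) / (real N ^ (2 * t) * (real N * real N ^ (t - 1)))"
    using n0 r t by (simp add: N_def power_mult_distrib power_divide divide_simps flip: power_mult) (simp add: mult_ac)
  also have "real N * real N ^ (t - 1) = real N ^ t" using t by (cases t) auto
  also have "2 * real N ^ (2 * t) * real t ^ (2 * t) / (real N ^ (2 * t) * real N ^ t) = 2 * real t ^ (2 * t) / real N ^ t"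
    using N by simp
  also have "\<dots> \<le> 2 * real t ^ (2 * t) / real n ^ t"
    using \<open>n \<le> N\<close> n0 by (intro divide_left_mono power_mono) auto
  finally show "top_kernel_weight r n t \<le> 2 * real t ^ (2 * t) / real n ^ t" .
qed

text \<open>The polynomial factor in the preceding identity is slowly varying and tends to 1, so it can be
  divided out.\<close>

lemma transversal_ratio_slowly_varying:
  assumes n: "filterlim n at_top F" and r: "r \<ge> 1"
    and struct: "eventually (\<lambda>x. finite (E x) \<and> card (E x) = r * n x \<and>
        finite (A x) \<and> f x ` E x \<subseteq> A x \<and> card (A x) = n x \<and> (\<forall>a\<in>A x. card {e \<in> E x. f x e = a} = r) \<and>
        finite (B x) \<and> g x ` E x \<subseteq> B x \<and> card (B x) = n x \<and> (\<forall>b\<in>B x. card {e \<in> E x. g x e = b} = r)) F"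
    and bounded: "\<And>t. t \<ge> 1 \<Longrightarrow> t \<le> m \<Longrightarrow> eventually (\<lambda>x. \<bar>mobius_pair_sum (f x) (g x) t (E x)\<bar> \<le> K) F"
  shows "slowly_varying F n m (\<lambda>x. transversal_ratio r (n x) (num_common_transversals (f x) (g x) (E x)))"
    and "eventually (\<lambda>x. transversal_ratio r (n x) (num_common_transversals (f x) (g x) (E x)) 0 = 1) F"
proof -
  let ?R = "\<lambda>x. transversal_ratio r (n x) (num_common_transversals (f x) (g x) (E x))"
  let ?q = "\<lambda>t x l. \<Prod>s<t - 1. 1 - real (l + s) / real (r * n x)"
  show R0: "eventually (\<lambda>x. ?R x 0 = 1) F"
    using struct
  proof eventually_elim
    case (elim x)
    then have "{S. S \<subseteq> E x \<and> card S = 0 \<and> inj_on (f x) S \<and> inj_on (g x) S} = {{}}"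
      by (auto dest: finite_subset)
    then show ?case by (simp add: transversal_ratio_def num_common_transversals_def)
  qed
  show "slowly_varying F n m ?R"
  proof (rule slowly_varying_of_mult[OF n, where q = ?q])
    fix t assume t: "t \<ge> 1" "t \<le> m"
    show "slowly_varying F n m (?q t)"
      by (intro slowly_varying_prod slowly_varying_linear n r)
    have "((\<lambda>x. ?q t x t) \<longlongrightarrow> (\<Prod>s<t - 1. 1 - real (t + s) / real r * 0)) F"
    proof -
      have inv0: "((\<lambda>x. 1 / real (n x)) \<longlongrightarrow> 0) F"
        using n filterlim_compose[OF lim_1_over_n] by blast
      have "((\<lambda>x. \<Prod>s<t - 1. 1 - real (t + s) / real r * (1 / real (n x))) \<longlongrightarrow> (\<Prod>s<t - 1. 1 - real (t + s) / real r * 0)) F"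
        by (intro tendsto_intros inv0)
      then show ?thesis by simp
    qed
    then show "((\<lambda>x. ?q t x t) \<longlongrightarrow> 1) F" by simp
    show "(\<lambda>x. (fwd_diff ^^ t) (\<lambda>l. ?R x l * ?q t x l) 0) \<in> O[F](\<lambda>x. 1 / real (n x) ^ t)"
    proof (rule bigoI[where c = "2 * real t ^ (2 * t) * K"])
      have "eventually (\<lambda>x. n x \<ge> 2 * t) F" using n by (simp add: filterlim_at_top)
      with struct bounded[OF t]
      show "eventually (\<lambda>x. norm ((fwd_diff ^^ t) (\<lambda>l. ?R x l * ?q t x l) 0)
          \<le> 2 * real t ^ (2 * t) * K * norm (1 / real (n x) ^ t)) F"
      proof eventually_elim
        case (elim x)
        let ?Z = "mobius_pair_sum (f x) (g x) t (E x)"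
        have "(fwd_diff ^^ t) (\<lambda>l. ?R x l * ?q t x l) 0 = top_kernel_weight r (n x) t * ?Z"
          using elim t r by (intro fwd_diff_transversal_ratio[where A = "A x" and B = "B x"]) auto
        moreover have "\<bar>top_kernel_weight r (n x) t * ?Z\<bar> \<le> 2 * real t ^ (2 * t) / real (n x) ^ t * K"
          unfolding abs_mult using elim top_kernel_weight_le[OF r t(1), of "n x"]
          by (intro mult_mono) auto
        ultimately show ?case by simp
      qed
    qed
  next
    show "(\<lambda>x. ?R x 0) \<in> O[F](\<lambda>x. 1)"
      by (rule bigoI[where c = 1], use R0 in eventually_elim) simp
  qed
qed

section \<open>Matchings of regular bipartite graphs as common transversals\<close>

lemma regular_bipartite_edgeD:
  assumes "e \<in> E" "E \<in> regular_bipartite_graphs r A B"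
  shows "\<exists>a\<in>A. \<exists>b\<in>B. e = {a, b}"
  using assms unfolding regular_bipartite_graphs_def by blast

lemma finite_regular_bipartite_graph:
  assumes "finite A" "finite B" "E \<in> regular_bipartite_graphs r A B"
  shows "finite E"
proof (rule finite_subset)
  show "E \<subseteq> (\<lambda>(a, b). {a, b}) ` (A \<times> B)"
  proof
    fix e assume "e \<in> E"
    then obtain a b where "a \<in> A" "b \<in> B" "e = {a, b}"
      using regular_bipartite_edgeD[OF _ assms(3)] by blast
    then show "e \<in> (\<lambda>(a, b). {a, b}) ` (A \<times> B)" by (intro image_eqI[of _ _ "(a, b)"]) simp_all
  qed
  show "finite ((\<lambda>(a, b). {a, b}) ` (A \<times> B))" using assms by simp
qed

lemma regular_bipartite_graphs_commute: "regular_bipartite_graphs r A B = regular_bipartite_graphs r B A"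
proof -
  have "{{a, b} | a b. a \<in> A \<and> b \<in> B} = {{a, b} | a b. a \<in> B \<and> b \<in> A}"
    by (rule Collect_cong) (metis insert_commute)
  then show ?thesis by (simp add: regular_bipartite_graphs_def Un_commute)
qed

lemma regular_bipartite_fibres:
  assumes "finite A" "A \<inter> B = {}" and E: "E \<in> regular_bipartite_graphs r A B"
  shows "(\<lambda>e. e \<inter> A) ` E \<subseteq> (\<lambda>a. {a}) ` A"
    and "\<forall>x \<in> (\<lambda>a. {a}) ` A. card {e \<in> E. e \<inter> A = x} = r"
proof -
  have Int: "\<exists>a\<in>A. e \<inter> A = {a}" if "e \<in> E" for e
    using regular_bipartite_edgeD[OF that E] assms(2) by auto
  then show "(\<lambda>e. e \<inter> A) ` E \<subseteq> (\<lambda>a. {a}) ` A" by (intro image_subsetI) (metis imageI)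
  show "\<forall>x \<in> (\<lambda>a. {a}) ` A. card {e \<in> E. e \<inter> A = x} = r"
  proof
    fix x assume "x \<in> (\<lambda>a. {a}) ` A"
    then obtain a where a: "a \<in> A" "x = {a}" by auto
    have "e \<inter> A = {a} \<longleftrightarrow> a \<in> e" if "e \<in> E" for e
      using Int[OF that] a(1) by (metis IntI IntD1 singletonD singletonI)
    then have "{e \<in> E. e \<inter> A = x} = {e \<in> E. a \<in> e}"
      using a(2) by blast
    then show "card {e \<in> E. e \<inter> A = x} = r"
      using E a by (simp add: regular_bipartite_graphs_def vdegree_def)
  qed
qed

lemma card_regular_bipartite_graph:
  assumes fin: "finite A" "finite B" and disj: "A \<inter> B = {}" and E: "E \<in> regular_bipartite_graphs r A B"
  shows "card E = r * card A"
proof -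
  have "E = (\<Union>x\<in>(\<lambda>a. {a}) ` A. {e \<in> E. e \<inter> A = x})"
    using regular_bipartite_fibres(1)[OF fin(1) disj E] by auto
  also have "card \<dots> = (\<Sum>x\<in>(\<lambda>a. {a}) ` A. card {e \<in> E. e \<inter> A = x})"
    using fin finite_regular_bipartite_graph[OF fin E] by (intro card_UN_disjoint) auto
  also have "\<dots> = (\<Sum>x\<in>(\<lambda>a. {a}) ` A. r)"
    using regular_bipartite_fibres(2)[OF fin(1) disj E] by (intro sum.cong) blast+
  also have "\<dots> = r * card A" by (simp add: card_image)
  finally show ?thesis .
qed

text \<open>The left and right endpoints of an edge \<open>e\<close> are represented by the singletons \<open>e \<inter> A\<close>
  and \<open>e \<inter> B\<close>, which avoids choosing elements.\<close>

lemma num_matchings_eq_num_common_transversals: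
  assumes fin: "finite A" "finite B" and disj: "A \<inter> B = {}" and E: "E \<in> regular_bipartite_graphs r A B"
  shows "num_matchings E l = num_common_transversals (\<lambda>e. e \<inter> A) (\<lambda>e. e \<inter> B) E l"
proof -
  have nonempty: "e \<inter> A \<noteq> {}" "e \<inter> B \<noteq> {}" "e \<subseteq> A \<union> B" if "e \<in> E" for e
    using regular_bipartite_edgeD[OF that E] by auto
  have singleton: "\<exists>a. e \<inter> A = {a}" "\<exists>b. e \<inter> B = {b}" if "e \<in> E" for e
    using regular_bipartite_edgeD[OF that E] disj by auto
  have disjnt_iff: "disjnt e e' \<longleftrightarrow> e \<inter> A \<noteq> e' \<inter> A \<and> e \<inter> B \<noteq> e' \<inter> B" if e: "e \<in> E" "e' \<in> E" for e e'
  proof -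
    obtain a b a' b' where "e \<inter> A = {a}" "e \<inter> B = {b}" "e' \<inter> A = {a'}" "e' \<inter> B = {b'}"
      using singleton e by metis
    moreover have "e \<inter> e' = (e \<inter> A) \<inter> (e' \<inter> A) \<union> (e \<inter> B) \<inter> (e' \<inter> B)"
      using nonempty(3)[OF e(1)] by blast
    ultimately show ?thesis by (auto simp: disjnt_def)
  qed
  have pairwise_iff: "pairwise disjnt M \<longleftrightarrow> inj_on (\<lambda>e. e \<inter> A) M \<and> inj_on (\<lambda>e. e \<inter> B) M" if M: "M \<subseteq> E" for M
  proof
    assume *: "pairwise disjnt M"
    show "inj_on (\<lambda>e. e \<inter> A) M \<and> inj_on (\<lambda>e. e \<inter> B) M"
    proof (intro conjI inj_onI; rule ccontr)
      fix e e' assume e: "e \<in> M" "e' \<in> M" "e \<noteq> e'"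
      then have "e \<inter> A \<noteq> e' \<inter> A \<and> e \<inter> B \<noteq> e' \<inter> B"
        using pairwiseD[OF * e] disjnt_iff M by blast
      then show "e \<inter> A = e' \<inter> A \<Longrightarrow> False" "e \<inter> B = e' \<inter> B \<Longrightarrow> False" by auto
    qed
  next
    assume *: "inj_on (\<lambda>e. e \<inter> A) M \<and> inj_on (\<lambda>e. e \<inter> B) M"
    show "pairwise disjnt M"
    proof (rule pairwiseI)
      fix e e' assume e: "e \<in> M" "e' \<in> M" "e \<noteq> e'"
      then have "e \<inter> A \<noteq> e' \<inter> A \<and> e \<inter> B \<noteq> e' \<inter> B"
        using * by (auto dest: inj_onD)
      then show "disjnt e e'" using disjnt_iff e M by blast
    qed
  qed
  have fin_sub: "finite M" if "M \<subseteq> E" for M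
    using finite_subset[OF that finite_regular_bipartite_graph[OF fin E]] .
  have "matchings E l = {S. S \<subseteq> E \<and> card S = l \<and> inj_on (\<lambda>e. e \<inter> A) S \<and> inj_on (\<lambda>e. e \<inter> B) S}"
    unfolding matchings_def by (rule Collect_cong) (metis pairwise_iff fin_sub)
  then show ?thesis by (simp add: num_matchings_def num_common_transversals_def)
qed

section \<open>The explicit part of the logarithm\<close>

text \<open>The mean number of \<open>l\<close>-matchings in the bipartite configuration model, in which the \<open>r n\<close> half-edges
  of each side are paired by a uniformly random bijection.\<close>

definition mean_matchings :: "nat \<Rightarrow> nat \<Rightarrow> nat \<Rightarrow> real" where
  "mean_matchings r n l = (real (n choose l) * real r ^ l)\<^sup>2 / real ((r * n) choose l)"

definition log_mean_diff :: "nat \<Rightarrow> nat \<Rightarrow> nat \<Rightarrow> real" where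
  "log_mean_diff r n l = ln (mean_matchings r n l / real r ^ l)
     - ln (complete_num_matchings (2 * n) l / (real (2 * n) - 1) ^ l)"

lemma mean_matchings_pos:
  assumes "r \<ge> 1" "l \<le> n"
  shows "mean_matchings r n l > 0"
proof -
  have "n \<le> r * n" using assms by simp
  then have "l \<le> r * n" using assms by linarith
  then show ?thesis using assms by (simp add: mean_matchings_def zero_less_binomial_iff)
qed

lemma log_matching_diff_eq:
  assumes r: "r \<ge> 1" and l: "l \<le> n" and R: "transversal_ratio r n (num_matchings E) l > 0"
  shows "log_matching_diff r (2 * n) E l = ln (transversal_ratio r n (num_matchings E) l) + log_mean_diff r n l"
proof -
  have M: "mean_matchings r n l > 0" using mean_matchings_pos[OF r l] .
  have "real (num_matchings E l) = transversal_ratio r n (num_matchings E) l * mean_matchings r n l"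
  proof -
    have "l \<le> r * n" using r l by (metis le_trans mult_le_mono1 mult_1)
    then have "real (n choose l) > 0" "real ((r * n) choose l) > 0" "real r > 0"
      using r l by (auto simp: zero_less_binomial_iff)
    then show ?thesis
      unfolding transversal_ratio_def mean_matchings_def by (simp add: field_simps)
  qed
  then have "ln (real (num_matchings E l) / real r ^ l)
      = ln (transversal_ratio r n (num_matchings E) l * (mean_matchings r n l / real r ^ l))"
    by simp
  also have "\<dots> = ln (transversal_ratio r n (num_matchings E) l) + ln (mean_matchings r n l / real r ^ l)"
    using R M r by (intro ln_mult_pos) auto
  finally show ?thesis by (simp add: log_matching_diff_def log_mean_diff_def)
qed

lemma of_nat_binomial_Suc:
  "l < n \<Longrightarrow> real (n choose Suc l) = real (n choose l) * (real n - real l) / real (Suc l)"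
proof -
  assume l: "l < n"
  have "Suc l * (n choose Suc l) = (n choose l) * (n - l)"
    using binomial_absorb_comp[of n l] binomial_absorption[of l n] by (simp only: mult.commute)
  have "real (Suc l) * real (n choose Suc l) = real (n choose l) * (real n - real l)"
    using arg_cong[where f = real, OF \<open>Suc l * (n choose Suc l) = (n choose l) * (n - l)\<close>] l
    by (simp only: of_nat_mult of_nat_diff less_imp_le)
  then show ?thesis by (simp add: field_simps del: binomial_Suc_Suc)
qed

lemma fwd_diff_log_mean_diff:
  assumes r: "r \<ge> 1" and l: "l < n"
  shows "fwd_diff (log_mean_diff r n) l
    = ln (real n - real l) - ln (real r * real n - real l) - ln (real n - 1/2 - real l)
      + (ln (real r) + ln (real n - 1/2))"
proof -
  define N where "N = r * n"
  have "n \<le> N" using r by (simp add: N_def)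
  then have lN: "l < N" using l by linarith
  define C where "C = (\<lambda>l. complete_num_matchings (2 * n) l / (real (2 * n) - 1) ^ l)"
  define M where "M = (\<lambda>l. mean_matchings r n l / real r ^ l)"
  have pos: "M l > 0" "M (Suc l) > 0" "C l > 0" "C (Suc l) > 0"
    using mean_matchings_pos[OF r, of l n] mean_matchings_pos[OF r, of "Suc l" n] l r
    by (auto simp: M_def C_def complete_num_matchings_def)
  have bpos: "real (n choose l) > 0" "real (N choose l) > 0"
    using l lN by (auto simp: zero_less_binomial_iff)
  have "M (Suc l) = M l * ((real n - l)\<^sup>2 * real r / (real (Suc l) * (real N - l)))"
    using r lN l bpos unfolding M_def mean_matchings_def N_def[symmetric] of_nat_binomial_Suc[OF l] of_nat_binomial_Suc[OF lN]
    by (simp add: divide_simps power2_eq_square del: of_nat_Suc) 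
  moreover have "C (Suc l) = C l * (2 * (real n - l) * (real n - 1/2 - l) / (real (Suc l) * (real n - 1/2) * 2))"
  proof -
    have "(fact (2 * n - 2 * l) :: real) = real (2 * n - 2 * l) * real (2 * n - 2 * l - 1) * fact (2 * n - 2 * Suc l)"
      using l by (simp add: fact_reduce numeral_2_eq_2)
    then have "(fact (2 * n - 2 * l) :: real) = (2 * (real n - l)) * (2 * (real n - 1/2 - l)) * fact (2 * n - 2 * Suc l)"
      using l by (simp add: of_nat_diff algebra_simps)
    then show ?thesis
      using l unfolding C_def complete_num_matchings_def fact_Suc[of l]
      by (simp add: divide_simps del: fact_Suc of_nat_Suc mult_Suc_right) (simp add: algebra_simps)
  qed
  moreover have alg: "(m * (a\<^sup>2 * \<rho> / (\<sigma> * b)) / m) / (c * (2 * a * d / (\<sigma> * k * 2)) / c) = a * (\<rho> * k) / (b * d)"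
    if "m > 0" "c > 0" "a > 0" "b > 0" "d > 0" "\<sigma> > 0" "k > 0" for m c a b d k \<rho> \<sigma> :: real
    using that by (simp add: field_simps power2_eq_square)
  ultimately have quot: "(M (Suc l) / M l) / (C (Suc l) / C l)
      = ((real n - l) * (real r * (real n - 1/2))) / ((real N - l) * (real n - 1/2 - l))"
    using pos(1,3) l lN by (simp only:)
  have "fwd_diff (log_mean_diff r n) l = ln (M (Suc l)) - ln (C (Suc l)) - (ln (M l) - ln (C l))"
    by (simp add: fwd_diff_def log_mean_diff_def M_def C_def)
  also have "\<dots> = ln ((M (Suc l) / M l) / (C (Suc l) / C l))"
    using pos by (simp add: ln_div ln_mult_pos)
  also have "\<dots> = ln (real n - l) + (ln r + ln (real n - 1/2)) - (ln (real N - l) + ln (real n - 1/2 - l))"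
    unfolding quot using l lN r by (subst ln_div, simp, simp, subst ln_mult_pos, simp, simp,
      subst ln_mult_pos, simp, simp, subst ln_mult_pos, simp, simp, simp)
  finally show ?thesis by (simp add: N_def)
qed

definition ln_deriv :: "real \<Rightarrow> nat \<Rightarrow> real \<Rightarrow> real" where
  "ln_deriv a j x = (if j = 0 then ln (a - x) else - fact (j - 1) / (a - x) ^ j)"

lemma has_real_derivative_ln_deriv:
  assumes "x < a"
  shows "(ln_deriv a j has_real_derivative ln_deriv a (Suc j) x) (at x)"
proof (cases j)
  case 0
  have "((\<lambda>x. ln (a - x)) has_real_derivative - 1 / (a - x)) (at x)"
    using assms by (auto intro!: derivative_eq_intros simp: divide_simps)
  then show ?thesis using 0 by (simp add: ln_deriv_def[abs_def])
next
  case (Suc i)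
  have "((\<lambda>x. - fact i / (a - x) ^ Suc i) has_real_derivative - fact (Suc i) / (a - x) ^ Suc (Suc i)) (at x)"
  proof -
    have "((\<lambda>x. - fact i / (a - x) ^ Suc i) has_real_derivative
       (0 * (a - x) ^ Suc i - - fact i * (real (Suc i) * (a - x) ^ i * (0 - 1))) / ((a - x) ^ Suc i * (a - x) ^ Suc i)) (at x)"
    proof (rule DERIV_divide)
      have "((\<lambda>x. a - x) has_real_derivative -1) (at x)"
        by (auto intro!: derivative_eq_intros)
      from DERIV_power_Suc[OF this, of i]
      show "((\<lambda>x. (a - x) ^ Suc i) has_real_derivative real (Suc i) * (a - x) ^ i * (0 - 1)) (at x)"
        by (simp add: algebra_simps del: power_Suc)
    qed (use assms in auto)
    also have "(0 * (a - x) ^ Suc i - - fact i * (real (Suc i) * (a - x) ^ i * (0 - 1))) / ((a - x) ^ Suc i * (a - x) ^ Suc i)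
      = - fact (Suc i) / (a - x) ^ Suc (Suc i)"
      using assms by (simp add: divide_simps)
    finally show ?thesis .
  qed
  then show ?thesis using Suc by (simp add: ln_deriv_def[abs_def] del: power_Suc fact_Suc)
qed

text \<open>The derivative of order \<open>h\<close> of \<open>ln (a - x)\<close> is \<open>-(h - 1)! / (a - x)\<^sup>h\<close>. The terms with \<open>a = n\<close> and
  \<open>a = n - 1/2\<close> together contribute a nonnegative amount, and the term with \<open>a = r n\<close> gives the bound.\<close>

lemma fwd_diff_pow_log_mean_diff_ge:
  assumes r: "r \<ge> 1" and h: "h \<ge> 1" and i: "i + h < n"
  shows "(fwd_diff ^^ Suc h) (log_mean_diff r n) i \<ge> fact (h - 1) / (real r * real n) ^ h"
proof -
  define G where "G = (\<lambda>j x. ln_deriv (real n) j x - ln_deriv (real r * real n) j x - ln_deriv (real n - 1/2) j x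
    + (if j = 0 then ln (real r) + ln (real n - 1/2) else 0))"
  have rn: "real n \<le> real r * real n" using r by (simp add: mult_le_cancel_right1)
  have deriv: "(G j has_real_derivative G (Suc j) x) (at x)" if "0 \<le> x" "x \<le> real (n - 1)" for j x
  proof -
    have "x < real n - 1/2" using that i by (simp add: of_nat_diff)
    then have "(G j has_real_derivative ln_deriv (real n) (Suc j) x - ln_deriv (real r * real n) (Suc j) x
        - ln_deriv (real n - 1/2) (Suc j) x + 0) (at x)"
      unfolding G_def using rn
      by (intro DERIV_add DERIV_diff has_real_derivative_ln_deriv DERIV_const) auto
    then show ?thesis by (simp add: G_def)
  qed
  have lower: "fact (h - 1) / (real r * real n) ^ h \<le> G h x" if x: "0 \<le> x" "x \<le> real (n - 1)" for x
  proof -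
    have x': "x < real n - 1/2" using that i by (simp add: of_nat_diff)
    have "fact (h - 1) / (real n - x) ^ h \<le> fact (h - 1) / (real n - 1/2 - x) ^ h"
      using x' by (intro divide_left_mono power_mono mult_pos_pos zero_less_power) auto
    moreover have "fact (h - 1) / (real r * real n) ^ h \<le> fact (h - 1) / (real r * real n - x) ^ h"
    proof -
      have p: "0 < real r * real n - x" "0 < real r * real n" using x x' rn by linarith+
      have "real r * real n - x \<le> real r * real n" using x by linarith
      then show ?thesis
        by (intro divide_left_mono power_mono mult_pos_pos zero_less_power p less_imp_le[OF p(1)])
          (use i r in simp_all)
    qed
    ultimately show ?thesis using h by (simp add: G_def ln_deriv_def)
  qed
  have "fact (h - 1) / (real r * real n) ^ h \<le> (fwd_diff ^^ h) (\<lambda>l. G 0 (real l)) i"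
    by (rule fwd_diff_pow_ge[where a = 0 and b = "real (n - 1)"]) (use deriv lower i in auto)
  also have "(fwd_diff ^^ h) (\<lambda>l. G 0 (real l)) i = (fwd_diff ^^ h) (fwd_diff (log_mean_diff r n)) i"
    using i by (intro fwd_diff_pow_cong) (simp add: fwd_diff_log_mean_diff[OF r] G_def ln_deriv_def)
  finally show ?thesis by (simp add: funpow_swap1)
qed

section \<open>Graphs with bounded pair sums\<close>

lemma fwd_diff_nonneg_if_second_diff_nonneg:
  assumes "f 0 = 0" "f (Suc 0) = 0" "\<And>j. j < i \<Longrightarrow> (fwd_diff ^^ 2) f j \<ge> 0"
  shows "fwd_diff f i \<ge> 0 \<and> f i \<ge> 0"
  using assms(3)
proof (induction i)
  case 0
  then show ?case using assms by (simp add: fwd_diff_def)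
next
  case (Suc i)
  then have IH: "fwd_diff f i \<ge> 0" "f i \<ge> 0" by auto
  have "(fwd_diff ^^ 2) f i = fwd_diff f (Suc i) - fwd_diff f i"
    by (simp add: numeral_2_eq_2 fwd_diff_def)
  then have "fwd_diff f (Suc i) \<ge> 0" using Suc.prems[of i] IH by simp
  moreover have "f (Suc i) = f i + fwd_diff f i" by (simp add: fwd_diff_def)
  ultimately show ?case using IH by simp
qed

lemma log_matching_diff_0: "log_matching_diff r v E 0 = 0"
proof -
  have "matchings E 0 = {{}}" by (auto simp: matchings_def)
  then show ?thesis by (simp add: log_matching_diff_def num_matchings_def complete_num_matchings_def)
qed

lemma log_matching_diff_1:
  assumes "card E = r * n" "r \<ge> 1" "n \<ge> 1"
  shows "log_matching_diff r (2 * n) E (Suc 0) = 0"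
proof -
  have "matchings E 1 = (\<lambda>e. {e}) ` E"
    by (auto simp: matchings_def card_1_singleton_iff)
  then have m: "num_matchings E 1 = r * n"
    using assms by (simp add: num_matchings_def card_image)
  have "(fact (2 * n) :: real) = real (2 * n) * real (2 * n - 1) * fact (2 * n - 2)"
    using assms by (simp add: fact_reduce numeral_2_eq_2)
  then have "complete_num_matchings (2 * n) 1 = real n * (real (2 * n) - 1)"
    using assms by (simp add: complete_num_matchings_def of_nat_diff)
  moreover have "real (2 * n) - 1 \<noteq> 0" using assms by simp
  ultimately show ?thesis
    using m assms by (simp add: log_matching_diff_def)
qed

context
  fixes A B :: "nat \<Rightarrow> 'a set" and r :: nat
  assumes fin: "\<And>n. finite (A n)" "\<And>n. finite (B n)" and disj: "\<And>n. A n \<inter> B n = {}"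
    and card: "\<And>n. card (A n) = n" "\<And>n. card (B n) = n" and r: "r \<ge> 1"
begin

text \<open>A property that holds eventually along this filter holds for all large \<open>n\<close>, uniformly over the graphs
  whose quantities \<open>Z\<^sub>t\<close> with \<open>1 \<le> t \<le> m\<close> are bounded by \<open>K\<close>.\<close>

definition bounded_graphs :: "nat \<Rightarrow> real \<Rightarrow> (nat \<times> 'a set set) filter" where
  "bounded_graphs m K = inf (filtercomap fst at_top) (principal {(n, E).
     E \<in> regular_bipartite_graphs r (A n) (B n) \<and>
     (\<forall>t\<in>{1..m}. \<bar>mobius_pair_sum (\<lambda>e. e \<inter> A n) (\<lambda>e. e \<inter> B n) t E\<bar> \<le> K)})"

lemma eventually_bounded_graphs:
  "eventually P (bounded_graphs m K) \<longleftrightarrow> (\<exists>n0. \<forall>n\<ge>n0. \<forall>E\<in>regular_bipartite_graphs r (A n) (B n).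
     (\<forall>t\<in>{1..m}. \<bar>mobius_pair_sum (\<lambda>e. e \<inter> A n) (\<lambda>e. e \<inter> B n) t E\<bar> \<le> K) \<longrightarrow> P (n, E))"
  unfolding bounded_graphs_def eventually_inf_principal eventually_filtercomap_at_top_linorder
  by auto

lemma filterlim_fst_bounded_graphs: "filterlim fst at_top (bounded_graphs m K)"
  unfolding bounded_graphs_def
  by (rule filterlim_mono[OF filterlim_filtercomap order_refl inf_le1])

text \<open>The explicit part contributes at least a constant times \<open>n\<^sup>1\<^sup>-\<^sup>k\<close>, and the logarithm of the ratio is
  \<open>O(n\<^sup>-\<^sup>k)\<close>.\<close>

lemma eventually_second_or_higher_diff_nonneg:
  assumes k: "k \<ge> 2" and m: "i + k + 1 \<le> m"
  shows "eventually (\<lambda>x. (fwd_diff ^^ k) (log_matching_diff r (2 * fst x) (snd x)) i \<ge> 0) (bounded_graphs m K)"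
proof -
  let ?F = "bounded_graphs m K"
  let ?f = "\<lambda>x e. e \<inter> A (fst x)" and ?g = "\<lambda>x e. e \<inter> B (fst x)"
  define R where "R = (\<lambda>x. transversal_ratio r (fst x) (num_common_transversals (?f x) (?g x) (snd x)))"
  note n = filterlim_fst_bounded_graphs[of m K]
  have good: "eventually (\<lambda>x. snd x \<in> regular_bipartite_graphs r (A (fst x)) (B (fst x)) \<and>
      (\<forall>t\<in>{1..m}. \<bar>mobius_pair_sum (?f x) (?g x) t (snd x)\<bar> \<le> K)) ?F"
    by (simp add: eventually_bounded_graphs)
  have struct: "eventually (\<lambda>x. finite (snd x) \<and> card (snd x) = r * fst x \<and>
        finite ((\<lambda>a. {a}) ` A (fst x)) \<and> ?f x ` snd x \<subseteq> (\<lambda>a. {a}) ` A (fst x) \<and> card ((\<lambda>a. {a}) ` A (fst x)) = fst x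
        \<and> (\<forall>a\<in>(\<lambda>a. {a}) ` A (fst x). card {e \<in> snd x. ?f x e = a} = r) \<and>
        finite ((\<lambda>b. {b}) ` B (fst x)) \<and> ?g x ` snd x \<subseteq> (\<lambda>b. {b}) ` B (fst x) \<and> card ((\<lambda>b. {b}) ` B (fst x)) = fst x
        \<and> (\<forall>b\<in>(\<lambda>b. {b}) ` B (fst x). card {e \<in> snd x. ?g x e = b} = r)) ?F"
    using good
  proof eventually_elim
    case (elim x)
    let ?A = "A (fst x)" and ?B = "B (fst x)"
    have E: "snd x \<in> regular_bipartite_graphs r ?A ?B" using elim by blast
    then have E': "snd x \<in> regular_bipartite_graphs r ?B ?A"
      by (simp only: regular_bipartite_graphs_commute)
    have disj': "?B \<inter> ?A = {}" using disj by blast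
    show ?case
      using finite_regular_bipartite_graph[OF fin E] card_regular_bipartite_graph[OF fin disj E] card fin
        regular_bipartite_fibres[OF fin(1) disj E] regular_bipartite_fibres[OF fin(2) disj' E']
      by (simp add: card_image)
  qed
  have bounded: "eventually (\<lambda>x. \<bar>mobius_pair_sum (?f x) (?g x) t (snd x)\<bar> \<le> K) ?F" if "t \<ge> 1" "t \<le> m" for t
    using good by eventually_elim (use that in auto)
  have R: "slowly_varying ?F fst m R" "eventually (\<lambda>x. R x 0 = 1) ?F"
    unfolding R_def by (rule transversal_ratio_slowly_varying[OF n r struct bounded]; assumption)+
  have "(\<lambda>x. (fwd_diff ^^ k) (\<lambda>l. ln (R x l)) i) \<in> O[?F](\<lambda>x. 1 / real (fst x) ^ k)"
    by (rule fwd_diff_ln_bigo(1)[OF n R]) (use k m in auto)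
  then obtain c where c: "c > 0"
    "eventually (\<lambda>x. norm ((fwd_diff ^^ k) (\<lambda>l. ln (R x l)) i) \<le> c * norm (1 / real (fst x) ^ k)) ?F"
    by (rule landau_o.bigE)
  have pos: "eventually (\<lambda>x. \<forall>l\<in>{i..i + k}. R x l > 0) ?F"
    by (intro eventually_ball_finite ballI fwd_diff_ln_bigo(2)[OF n R, of 1]) (use m in auto)
  obtain h where h: "k = Suc h" "h \<ge> 1" using k by (cases k) auto
  \<comment> \<open>With \<open>n \<ge> c r\<^sup>h\<close> the error \<open>c / n\<^sup>k\<close> is at most \<open>1 / (r n)\<^sup>h\<close>.\<close>
  have "eventually (\<lambda>x. fst x \<ge> nat \<lceil>c * real r ^ h\<rceil> + i + k + 1) ?F"
    using n by (simp add: filterlim_at_top)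
  with c(2) pos good
  have "eventually (\<lambda>x. (fwd_diff ^^ k) (log_matching_diff r (2 * fst x) (snd x)) i \<ge> 0) ?F"
  proof eventually_elim
    case (elim x)
    define \<nu> where "\<nu> = fst x"
    have E: "snd x \<in> regular_bipartite_graphs r (A \<nu>) (B \<nu>)" using elim by (simp add: \<nu>_def)
    have big: "c * real r ^ h \<le> real \<nu>" "i + k < \<nu>"
      using elim(4) by (auto simp: \<nu>_def) linarith
    have "num_matchings (snd x) = num_common_transversals (?f x) (?g x) (snd x)"
      using num_matchings_eq_num_common_transversals[OF fin disj E] by (simp add: \<nu>_def fun_eq_iff)
    then have Rx: "R x = transversal_ratio r \<nu> (num_matchings (snd x))" by (simp add: R_def \<nu>_def)
    have "(fwd_diff ^^ k) (log_matching_diff r (2 * \<nu>) (snd x)) i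
        = (fwd_diff ^^ k) (\<lambda>l. ln (R x l) + log_mean_diff r \<nu> l) i"
      unfolding Rx
      by (intro fwd_diff_pow_cong log_matching_diff_eq r) (use elim(2) big in \<open>auto simp: Rx\<close>)
    also have "\<dots> = (fwd_diff ^^ k) (\<lambda>l. ln (R x l)) i + (fwd_diff ^^ k) (log_mean_diff r \<nu>) i"
      by (rule fwd_diff_pow_add)
    also have "\<dots> \<ge> 0"
    proof -
      have "\<bar>(fwd_diff ^^ k) (\<lambda>l. ln (R x l)) i\<bar> \<le> c / real \<nu> ^ k"
        using elim(1) by (simp add: \<nu>_def)
      also have "c / real \<nu> ^ k \<le> 1 / (real r * real \<nu>) ^ h"
      proof -
        have "c * real r ^ h / (real r ^ h * real \<nu> ^ k) \<le> real \<nu> / (real r ^ h * real \<nu> ^ k)"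
          using big by (intro divide_right_mono) auto
        then show ?thesis using r big h by (simp add: power_mult_distrib)
      qed
      also have "\<dots> \<le> fact (h - 1) / (real r * real \<nu>) ^ h"
        by (intro divide_right_mono) (auto simp: fact_ge_1)
      also have "\<dots> \<le> (fwd_diff ^^ k) (log_mean_diff r \<nu>) i"
        unfolding h(1) by (rule fwd_diff_pow_log_mean_diff_ge[OF r h(2)]) (use big h in auto)
      finally show ?thesis by linarith
    qed
    finally show ?case by (simp add: \<nu>_def)
  qed
  then show ?thesis .
qed

lemma eventually_diff_nonneg:
  assumes m: "i + k + 3 \<le> m"
  shows "eventually (\<lambda>x. (fwd_diff ^^ k) (log_matching_diff r (2 * fst x) (snd x)) i \<ge> 0) (bounded_graphs m K)"
proof (cases "k \<ge> 2")
  case True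
  then show ?thesis using m by (intro eventually_second_or_higher_diff_nonneg) auto
next
  case False
  have "eventually (\<lambda>x. \<forall>j\<in>{..<i}. (fwd_diff ^^ 2) (log_matching_diff r (2 * fst x) (snd x)) j \<ge> 0) (bounded_graphs m K)"
    using m eventually_second_or_higher_diff_nonneg[of 2 _ m K]
    by (intro eventually_ball_finite ballI) auto
  moreover have "eventually (\<lambda>x. fst x \<ge> 1) (bounded_graphs m K)"
    using filterlim_fst_bounded_graphs[of m K] by (simp add: filterlim_at_top)
  moreover have "eventually (\<lambda>x. snd x \<in> regular_bipartite_graphs r (A (fst x)) (B (fst x))) (bounded_graphs m K)"
    by (simp add: eventually_bounded_graphs)
  ultimately have "eventually (\<lambda>x. (fwd_diff ^^ k) (log_matching_diff r (2 * fst x) (snd x)) i \<ge> 0) (bounded_graphs m K)"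
  proof eventually_elim
    case (elim x)
    let ?d = "log_matching_diff r (2 * fst x) (snd x)"
    have "?d (Suc 0) = 0"
      using elim card_regular_bipartite_graph[OF fin disj elim(3)] card r by (intro log_matching_diff_1) auto
    then have "fwd_diff ?d i \<ge> 0 \<and> ?d i \<ge> 0"
      using elim by (intro fwd_diff_nonneg_if_second_diff_nonneg log_matching_diff_0) auto
    moreover have "k = 0 \<or> k = 1" using False by auto
    ultimately show ?case by auto
  qed
  then show ?thesis .
qed

end

section \<open>Switchings\<close>

lemma vdegree_switch:
  assumes E: "finite E" and dist: "a \<noteq> a'" "b \<noteq> b'" "a \<noteq> b" "a \<noteq> b'" "a' \<noteq> b" "a' \<noteq> b'"
    and edges: "{a, b} \<in> E" "{a', b'} \<in> E" "{a, b'} \<notin> E" "{a', b} \<notin> E"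
  shows "vdegree (E - {{a, b}, {a', b'}} \<union> {{a, b'}, {a', b}}) x = vdegree E x"
proof -
  define V R I where "V = {e \<in> E. x \<in> e}" and "R = {e \<in> {{a, b}, {a', b'}}. x \<in> e}"
    and "I = {e \<in> {{a, b'}, {a', b}}. x \<in> e}"
  have fin: "finite V" "finite R" "finite I" using E by (auto simp: V_def R_def I_def)
  have sub: "R \<subseteq> V" "(V - R) \<inter> I = {}" using edges by (auto simp: V_def R_def I_def)
  have two: "card {e \<in> {e1, e2}. x \<in> e} = of_bool (x \<in> e1) + of_bool (x \<in> e2)" if "e1 \<noteq> e2" for e1 e2 :: "'a set"
  proof -
    have "{e \<in> {e1, e2}. x \<in> e} = (if x \<in> e1 then {e1} else {}) \<union> (if x \<in> e2 then {e2} else {})" by auto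
    then show ?thesis using that by auto
  qed
  have ne: "{a, b} \<noteq> {a', b'}" "{a, b'} \<noteq> {a', b}" using dist by (auto simp: doubleton_eq_iff)
  have "card R = card I"
    unfolding R_def I_def two[OF ne(1)] two[OF ne(2)] using dist by auto
  have "{e \<in> E - {{a, b}, {a', b'}} \<union> {{a, b'}, {a', b}}. x \<in> e} = (V - R) \<union> I"
    by (auto simp: V_def R_def I_def)
  then have "vdegree (E - {{a, b}, {a', b'}} \<union> {{a, b'}, {a', b}}) x = card ((V - R) \<union> I)"
    by (simp add: vdegree_def)
  also have "\<dots> = card (V - R) + card I" using fin sub by (intro card_Un_disjoint) auto
  also have "card (V - R) = card V - card R" using fin sub by (intro card_Diff_subset) auto
  also have "card V - card R + card I = card V"
    using \<open>card R = card I\<close> card_mono[OF fin(1) sub(1)] by simp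
  finally show ?thesis by (simp add: V_def vdegree_def)
qed

locale bipartition =
  fixes A B :: "'a set" and n r :: nat
  assumes fin: "finite A" "finite B" and disj: "A \<inter> B = {}" and card_AB: "card A = n" "card B = n"
begin

abbreviation graphs :: "'a set set set" where "graphs \<equiv> regular_bipartite_graphs r A B"

abbreviation complete_edges :: "'a set set" where "complete_edges \<equiv> {{a, b} | a b. a \<in> A \<and> b \<in> B}"

lemma finite_complete_edges: "finite complete_edges"
proof -
  have "complete_edges = (\<lambda>(a, b). {a, b}) ` (A \<times> B)" by auto
  then show ?thesis using fin by simp
qed

lemma finite_graphs: "finite graphs"
  by (rule finite_subset[of _ "Pow complete_edges"])
    (auto simp: regular_bipartite_graphs_def finite_complete_edges simp del: Pow_iff intro!: PowI)

lemma edge_pair_eq_iff: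
  "a \<in> A \<Longrightarrow> a' \<in> A \<Longrightarrow> b \<in> B \<Longrightarrow> b' \<in> B \<Longrightarrow> {a, b} = {a', b'} \<longleftrightarrow> a = a' \<and> b = b'"
  using disj by (auto simp: doubleton_eq_iff)

definition num_containing :: "'a set set \<Rightarrow> nat" where
  "num_containing W = card {E \<in> graphs. W \<subseteq> E}"

lemma card_neighbours:
  assumes E: "E \<in> graphs"
  shows "a \<in> A \<Longrightarrow> card {b \<in> B. {a, b} \<in> E} = r" "b \<in> B \<Longrightarrow> card {a \<in> A. {a, b} \<in> E} = r"
proof -
  have sub: "E \<subseteq> complete_edges" and deg: "vdegree E x = r" if "x \<in> A \<union> B" for x
    using E that by (auto simp: regular_bipartite_graphs_def)
  show "card {b \<in> B. {a, b} \<in> E} = r" if a: "a \<in> A"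
  proof -
    have "bij_betw (\<lambda>b. {a, b}) {b \<in> B. {a, b} \<in> E} {e \<in> E. a \<in> e}"
    proof (rule bij_betw_imageI)
      show "inj_on (\<lambda>b. {a, b}) {b \<in> B. {a, b} \<in> E}" by (auto simp: inj_on_def doubleton_eq_iff)
      show "(\<lambda>b. {a, b}) ` {b \<in> B. {a, b} \<in> E} = {e \<in> E. a \<in> e}"
      proof (intro equalityI subsetI)
        fix e assume e: "e \<in> {e \<in> E. a \<in> e}"
        then obtain a' b where ab: "a' \<in> A" "b \<in> B" "e = {a', b}"
          using regular_bipartite_edgeD[OF _ E] by blast
        then have "a' = a" using a e disj by auto
        then show "e \<in> (\<lambda>b. {a, b}) ` {b \<in> B. {a, b} \<in> E}" using ab e by auto
      qed auto
    qed
    then show ?thesis using deg[of a] a by (simp add: bij_betw_same_card vdegree_def)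
  qed
  show "card {a \<in> A. {a, b} \<in> E} = r" if b: "b \<in> B"
  proof -
    have "bij_betw (\<lambda>a. {a, b}) {a \<in> A. {a, b} \<in> E} {e \<in> E. b \<in> e}"
    proof (rule bij_betw_imageI)
      show "inj_on (\<lambda>a. {a, b}) {a \<in> A. {a, b} \<in> E}" by (auto simp: inj_on_def doubleton_eq_iff)
      show "(\<lambda>a. {a, b}) ` {a \<in> A. {a, b} \<in> E} = {e \<in> E. b \<in> e}"
      proof (intro equalityI subsetI)
        fix e assume e: "e \<in> {e \<in> E. b \<in> e}"
        then obtain a b' where ab: "a \<in> A" "b' \<in> B" "e = {a, b'}"
          using regular_bipartite_edgeD[OF _ E] by blast
        then have "b' = b" using b e disj by auto
        then show "e \<in> (\<lambda>a. {a, b}) ` {a \<in> A. {a, b} \<in> E}" using ab e by auto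
      qed auto
    qed
    then show ?thesis using deg[of b] b by (simp add: bij_betw_same_card vdegree_def)
  qed
qed

text \<open>The switching in question replaces \<open>{a, b}\<close> and \<open>{a', b'}\<close> by \<open>{a, b'}\<close> and \<open>{a', b}\<close>. It must not
  create a multiple edge, and \<open>W\<close> is a set of edges to be kept.\<close>

definition switch_partners :: "'a set set \<Rightarrow> 'a \<Rightarrow> 'a \<Rightarrow> 'a set set \<Rightarrow> ('a \<times> 'a) set" where
  "switch_partners W a b E = {(a', b'). a' \<in> A \<and> b' \<in> B \<and> {a', b'} \<in> E \<and> {a', b'} \<notin> W
     \<and> {a, b'} \<notin> E \<and> {a', b} \<notin> E}"

text \<open>Of the \<open>r n\<close> edges, at most \<open>|W|\<close> are excluded by \<open>W\<close>, at most \<open>r\<^sup>2\<close> have their right end adjacent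
  to \<open>a\<close>, and at most \<open>r\<^sup>2\<close> have their left end adjacent to \<open>b\<close>.\<close>

lemma card_switch_partners_ge:
  assumes E: "E \<in> graphs" and ab: "a \<in> A" "b \<in> B" and W: "finite W"
  shows "r * n \<le> card (switch_partners W a b E) + card W + 2 * r ^ 2"
proof -
  let ?N = "\<lambda>a. {b \<in> B. {a, b} \<in> E}" and ?M = "\<lambda>b. {a \<in> A. {a, b} \<in> E}"
  have "card (SIGMA a':A. ?N a') = (\<Sum>a'\<in>A. card (?N a'))"
    using fin by (intro card_SigmaI) auto
  also have "\<dots> = r * n" using card_neighbours(1)[OF E] card_AB by simp
  finally have "r * n = card (SIGMA a':A. ?N a')" by simp
  also have "\<dots> \<le> card (switch_partners W a b E \<union> {(a', b') \<in> A \<times> B. {a', b'} \<in> W}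
      \<union> prod.swap ` (SIGMA b':?N a. ?M b') \<union> (SIGMA a':?M b. ?N a'))"
    using fin ab by (intro card_mono)
      (auto simp: switch_partners_def intro: finite_subset[of _ "A \<times> B"] simp: image_iff)
  also have "\<dots> \<le> card (switch_partners W a b E) + card {(a', b') \<in> A \<times> B. {a', b'} \<in> W}
      + card (prod.swap ` (SIGMA b':?N a. ?M b')) + card (SIGMA a':?M b. ?N a')"
    by (intro order_trans[OF card_Un_le] add_mono order_refl)
  also have "card {(a', b') \<in> A \<times> B. {a', b'} \<in> W} \<le> card W"
  proof (rule card_inj_on_le[of "\<lambda>(a', b'). {a', b'}"])
    show "inj_on (\<lambda>(a', b'). {a', b'}) {(a', b') \<in> A \<times> B. {a', b'} \<in> W}"
      using edge_pair_eq_iff by (auto simp: inj_on_def)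
  qed (use W in auto)
  also have "card (prod.swap ` (SIGMA b':?N a. ?M b')) = card (SIGMA b':?N a. ?M b')"
    by (intro card_image) auto
  also have "card (SIGMA b':?N a. ?M b') = (\<Sum>b'\<in>?N a. card (?M b'))"
    using fin by (intro card_SigmaI) auto
  also have "\<dots> = r * r" using card_neighbours[OF E] ab by simp
  also have "card (SIGMA a':?M b. ?N a') = (\<Sum>a'\<in>?M b. card (?N a'))"
    using fin by (intro card_SigmaI) auto
  also have "\<dots> = r * r" using card_neighbours[OF E] ab by simp
  finally show ?thesis by (simp add: power2_eq_square)
qed

text \<open>A switching removes \<open>{a, b}\<close> and keeps \<open>W\<close>. It can be undone in at most \<open>r\<^sup>2\<close> ways, since \<open>b'\<close> is a
  neighbour of \<open>a\<close> and \<open>a'\<close> is a neighbour of \<open>b\<close> in the new graph.\<close>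

lemma num_containing_insert:
  assumes ab: "a \<in> A" "b \<in> B" and W: "finite W" "{a, b} \<notin> W" 
  shows "(r * n - (card W + 1 + 2 * r ^ 2)) * num_containing (insert {a, b} W) \<le> r ^ 2 * num_containing W"
proof -
  let ?W = "insert {a, b} W"
  let ?P = "SIGMA E:{E \<in> graphs. ?W \<subseteq> E}. switch_partners ?W a b E"
  let ?Q = "SIGMA E:{E \<in> graphs. W \<subseteq> E}. {a' \<in> A. {a', b} \<in> E} \<times> {b' \<in> B. {a, b'} \<in> E}"
  let ?f = "\<lambda>(E, (a', b')). (E - {{a, b}, {a', b'}} \<union> {{a, b'}, {a', b}}, (a', b'))"
  have finG: "finite {E \<in> graphs. Q E}" for Q using finite_graphs by simp
  have finE: "finite E" if "E \<in> graphs" for E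
    using finite_regular_bipartite_graph[OF fin that] .
  have finS: "finite (switch_partners ?W a b E)" for E
    by (rule finite_subset[of _ "A \<times> B"]) (use fin in \<open>auto simp: switch_partners_def\<close>)
  have "(r * n - (card W + 1 + 2 * r ^ 2)) * num_containing ?W
      = (\<Sum>E\<in>{E \<in> graphs. ?W \<subseteq> E}. r * n - (card W + 1 + 2 * r ^ 2))"
    by (simp add: num_containing_def)
  also have "\<dots> \<le> (\<Sum>E\<in>{E \<in> graphs. ?W \<subseteq> E}. card (switch_partners ?W a b E))"
  proof (rule sum_mono)
    fix E assume "E \<in> {E \<in> graphs. ?W \<subseteq> E}"
    then show "r * n - (card W + 1 + 2 * r ^ 2) \<le> card (switch_partners ?W a b E)"
      using card_switch_partners_ge[of E a b ?W] ab W by simp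
  qed
  also have "\<dots> = card ?P" using finS finG by (intro card_SigmaI[symmetric]) auto
  also have "\<dots> \<le> card ?Q"
  proof (rule card_inj_on_le)
    have props: "a \<noteq> a'" "b \<noteq> b'" "a \<noteq> b" "a \<noteq> b'" "a' \<noteq> b" "a' \<noteq> b'" "{a, b} \<in> E" "{a', b'} \<in> E"
        "{a, b'} \<notin> E" "{a', b} \<notin> E" "a' \<in> A" "b' \<in> B" "{a', b'} \<notin> W" "W \<subseteq> E" "E \<in> graphs"
      if "(E, (a', b')) \<in> ?P" for E a' b'
      using that ab disj by (auto simp: switch_partners_def)
    show "inj_on ?f ?P"
    proof (rule inj_onI)
      fix p q assume p: "p \<in> ?P" and q: "q \<in> ?P" and eq: "?f p = ?f q"
      obtain E a1 b1 where p': "p = (E, (a1, b1))" by (metis prod.exhaust)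
      obtain F a2 b2 where q': "q = (F, (a2, b2))" by (metis prod.exhaust)
      have [simp]: "a2 = a1" "b2 = b1" using eq by (auto simp: p' q')
      note pE = props[OF p[unfolded p']] and pF = props[OF q[unfolded q']]
      have "E = (E - {{a, b}, {a1, b1}} \<union> {{a, b1}, {a1, b}}) - {{a, b1}, {a1, b}} \<union> {{a, b}, {a1, b1}}"
        using pE by auto
      also have "\<dots> = (F - {{a, b}, {a1, b1}} \<union> {{a, b1}, {a1, b}}) - {{a, b1}, {a1, b}} \<union> {{a, b}, {a1, b1}}"
        using eq by (simp add: p' q')
      also have "\<dots> = F" using pF by auto
      finally show "p = q" by (simp add: p' q')
    qed
    show "?f ` ?P \<subseteq> ?Q"
    proof (rule image_subsetI)
      fix p assume p: "p \<in> ?P"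
      obtain E a' b' where p': "p = (E, (a', b'))" by (metis prod.exhaust)
      note pE = props[OF p[unfolded p']]
      let ?F = "E - {{a, b}, {a', b'}} \<union> {{a, b'}, {a', b}}"
      have "?F \<in> graphs"
        using pE(15) vdegree_switch[OF finE[OF pE(15)] pE(1-10)] pE(11,12) ab
        unfolding regular_bipartite_graphs_def by auto
      moreover have "W \<subseteq> ?F" using pE W(2) by auto
      ultimately show "?f p \<in> ?Q" using pE(11,12) ab by (simp add: p')
    qed
    show "finite ?Q" using finG fin by (intro finite_SigmaI) auto
  qed
  also have "card ?Q = (\<Sum>E\<in>{E \<in> graphs. W \<subseteq> E}. card ({a' \<in> A. {a', b} \<in> E} \<times> {b' \<in> B. {a, b'} \<in> E}))"
    using finG fin by (intro card_SigmaI) auto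
  also have "\<dots> = (\<Sum>E\<in>{E \<in> graphs. W \<subseteq> E}. r ^ 2)"
    using card_neighbours ab by (intro sum.cong refl) (simp add: card_cartesian_product power2_eq_square)
  also have "\<dots> = r ^ 2 * num_containing W" by (simp add: num_containing_def)
  finally show ?thesis .
qed

text \<open>In terms of probabilities: the edges of \<open>W\<close> are present with probability at most \<open>(2 r / n)\<close> to the
  power \<open>|W|\<close>.\<close>

lemma num_containing_le:
  assumes W: "W \<subseteq> complete_edges" "card W \<le> w" and n: "2 * (w + 1 + 2 * r ^ 2) \<le> r * n"
  shows "real (num_containing W) \<le> (2 * real r / real n) ^ card W * real (card graphs)"
proof -
  have "finite W" using W(1) finite_complete_edges by (rule finite_subset)
  then show ?thesis using W
  proof (induction W rule: finite_induct)
    case empty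
    then show ?case by (simp add: num_containing_def)
  next
    case (insert e W)
    obtain a b where e: "e = {a, b}" "a \<in> A" "b \<in> B" using insert.prems by auto
    have IH: "real (num_containing W) \<le> (2 * real r / real n) ^ card W * real (card graphs)"
      using insert by auto
    have n0: "r * n > 0" by (rule less_le_trans[OF _ n]) simp
    then have pos: "real r > 0" "real n > 0" by auto
    have "card W \<le> w" using insert by simp
    define d where "d = card W + 1 + 2 * r ^ 2"
    \<comment> \<open>As \<open>d\<close> is at most half the number of edges, at least half of the edges are switching partners.\<close>
    have "2 * d \<le> 2 * (w + 1 + 2 * r ^ 2)" using \<open>card W \<le> w\<close> by (simp add: d_def)
    also note n
    finally have "r * n \<le> 2 * (r * n - d)" by simp
    then have half: "r * n \<le> 2 * (r * n - (card W + 1 + 2 * r ^ 2))" by (simp only: d_def)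
    have "(r * n) * num_containing (insert e W)
        \<le> 2 * ((r * n - (card W + 1 + 2 * r ^ 2)) * num_containing (insert e W))"
      using mult_le_mono1[OF half, of "num_containing (insert e W)"] by (simp add: mult.assoc)
    also have "\<dots> \<le> 2 * (r ^ 2 * num_containing W)"
      using num_containing_insert[of a b W] e insert.hyps by simp
    finally have "real (r * n * num_containing (insert e W)) \<le> real (2 * (r ^ 2 * num_containing W))"
      by (simp only: of_nat_le_iff)
    then have "real r * real n * real (num_containing (insert e W)) \<le> 2 * real r ^ 2 * real (num_containing W)"
      by simp
    then have "real (num_containing (insert e W)) \<le> (2 * real r / real n) * real (num_containing W)"
      using pos by (simp add: field_simps power2_eq_square)
    also have "\<dots> \<le> (2 * real r / real n) * ((2 * real r / real n) ^ card W * real (card graphs))"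
      by (intro mult_left_mono IH) simp
    finally show ?case using insert.hyps by simp
  qed
qed

end

section \<open>The mean of the pair sums\<close>

lemma card_image_mated_le:
  assumes T: "finite T" and mated: "\<forall>e\<in>T. \<exists>e'\<in>T. e' \<noteq> e \<and> f e' = f e"
  shows "2 * card (f ` T) \<le> card T"
proof -
  have "2 * card (f ` T) = (\<Sum>y\<in>f ` T. 2)" by simp
  also have "\<dots> \<le> (\<Sum>y\<in>f ` T. card {e \<in> T. f e = y})"
  proof (rule sum_mono)
    fix y assume "y \<in> f ` T"
    then obtain e e' where "e \<in> T" "e' \<in> T" "e' \<noteq> e" "f e = y" "f e' = y" using mated by force
    then have "{e, e'} \<subseteq> {e \<in> T. f e = y}" "card {e, e'} = 2" by auto
    moreover have "finite {e \<in> T. f e = y}" using T by simp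
    ultimately show "2 \<le> card {e \<in> T. f e = y}" by (metis card_mono)
  qed
  also have "\<dots> = card T"
    using sum.image_gen[OF T, of "\<lambda>_. 1::nat" f] by simp
  finally show ?thesis .
qed

text \<open>The elements of \<open>T\<close> share their values in groups of at least two, and each element of \<open>T' - T\<close> adds at
  most one new value.\<close>

lemma card_image_Un_mated_le:
  assumes "finite T" "finite T'" "\<forall>e\<in>T. \<exists>e'\<in>T. e' \<noteq> e \<and> f e' = f e"
  shows "2 * card (f ` (T \<union> T')) \<le> card T + 2 * card (T' - T)"
proof -
  have "f ` (T \<union> T') = f ` T \<union> f ` (T' - T)" by auto
  then have "card (f ` (T \<union> T')) \<le> card (f ` T) + card (f ` (T' - T))" by (simp add: card_Un_le)
  also have "card (f ` (T' - T)) \<le> card (T' - T)" using assms by (intro card_image_le) auto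
  finally show ?thesis using card_image_mated_le[OF assms(1,3)] by linarith
qed

lemma card_small_subsets_le:
  assumes "finite S" "card S = n" "n \<ge> 1"
  shows "card {P. P \<subseteq> S \<and> card P \<le> h} \<le> (h + 1) * n ^ h"
proof -
  have "{P. P \<subseteq> S \<and> card P \<le> h} = (\<Union>j\<in>{..h}. {P. P \<subseteq> S \<and> card P = j})" by auto
  also have "card \<dots> \<le> (\<Sum>j\<le>h. card {P. P \<subseteq> S \<and> card P = j})"
    by (rule card_UN_le) simp
  also have "\<dots> = (\<Sum>j\<le>h. n choose j)" using assms by (simp add: n_subsets)
  also have "\<dots> \<le> (\<Sum>j\<le>h. n ^ h)"
  proof (rule sum_mono)
    fix j assume "j \<in> {..h}"
    then have "n ^ j \<le> n ^ h" using assms by (intro power_increasing) auto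
    moreover have "n choose j \<le> n ^ j"
      using binomial_le_pow[of j n] by (cases "j \<le> n") (auto simp: binomial_eq_0)
    ultimately show "n choose j \<le> n ^ h" by linarith
  qed
  also have "\<dots> = (h + 1) * n ^ h" by simp
  finally show ?thesis .
qed

text \<open>The summand for \<open>c = |T - T'|\<close> collects the constants in the bounds for the two Moebius transforms,
  for the number of pairs, for the kernel and for the probability that a pair is present.\<close>

definition mean_bound :: "nat \<Rightarrow> nat \<Rightarrow> real" where
  "mean_bound r t = (\<Sum>c\<le>t. 4 ^ t * (2 * real t + 1) ^ 2 * 4 ^ ((2 * t) ^ 2) * (2 * real t) ^ c * (2 * real r) ^ (t + c))"

context bipartition
begin

text \<open>The pairs \<open>(T, T')\<close> for which the corresponding term of \<open>Z\<^sub>t\<close> can be nonzero.\<close>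

definition mated_pairs :: "nat \<Rightarrow> nat \<Rightarrow> ('a set set \<times> 'a set set) set" where
  "mated_pairs t c = {(T, T'). T \<subseteq> complete_edges \<and> T' \<subseteq> complete_edges \<and> card T = t \<and> card T' = t \<and> card (T - T') = c \<and>
     (\<forall>e\<in>T. \<exists>e'\<in>T. e' \<noteq> e \<and> e' \<inter> A = e \<inter> A) \<and> (\<forall>e\<in>T'. \<exists>e'\<in>T'. e' \<noteq> e \<and> e' \<inter> B = e \<inter> B)}"

lemma finite_mated_pairs: "finite (mated_pairs t c)"
  by (rule finite_subset[of _ "Pow complete_edges \<times> Pow complete_edges"])
    (use finite_complete_edges in \<open>auto simp: mated_pairs_def simp del: Pow_iff intro!: PowI\<close>)

text \<open>The set \<open>T \<union> T'\<close> has at most \<open>h = \<lfloor>(t + 2 c) / 2\<rfloor>\<close> endpoints on either side. After a choice of these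
  endpoints only boundedly many pairs are left.\<close>

lemma card_mated_pairs_le:
  assumes n: "n \<ge> 1" and c: "c \<le> t"
  shows "card (mated_pairs t c) \<le> (2 * t + 1) ^ 2 * 4 ^ ((2 * t) ^ 2) * n ^ (t + 2 * c)"
proof -
  \<comment> \<open>Rounding down is harmless: \<open>2 * h\<close> is the exponent of \<open>n\<close>, and it is at most \<open>t + 2 * c\<close>.\<close>
  define h where "h = (t + 2 * c) div 2"
  have h: "h \<le> 2 * t" "2 * h \<le> t + 2 * c" using c by (auto simp: h_def)
  let ?A = "(\<lambda>a. {a}) ` A" and ?B = "(\<lambda>b. {b}) ` B"
  let ?\<P> = "{P. P \<subseteq> ?A \<and> card P \<le> h} \<times> {Q. Q \<subseteq> ?B \<and> card Q \<le> h}"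
  let ?K = "\<lambda>P Q. (\<lambda>(p, q). p \<union> q) ` (P \<times> Q)"
  have finAB: "finite ?A" "finite ?B" "card ?A = n" "card ?B = n"
    using fin card_AB by (auto simp: card_image)
  have fin\<P>: "finite ?\<P>" using finAB by (intro finite_cartesian_product) auto
  have finK: "finite (case PQ of (P, Q) \<Rightarrow> Pow (?K P Q) \<times> Pow (?K P Q))" if "PQ \<in> ?\<P>" for PQ
  proof -
    obtain P Q where PQ: "PQ = (P, Q)" by (cases PQ)
    then have "P \<subseteq> ?A" "Q \<subseteq> ?B" using that by auto
    then have "finite P" "finite Q" using finAB finite_subset by blast+
    then show ?thesis unfolding PQ by simp
  qed
  have "mated_pairs t c \<subseteq> (\<Union>(P, Q)\<in>?\<P>. Pow (?K P Q) \<times> Pow (?K P Q))"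
  proof
    fix p assume p: "p \<in> mated_pairs t c"
    obtain T T' where p': "p = (T, T')" by (cases p)
    have T: "T \<subseteq> complete_edges" "T' \<subseteq> complete_edges" "card T = t" "card T' = t" "card (T - T') = c"
      "\<forall>e\<in>T. \<exists>e'\<in>T. e' \<noteq> e \<and> e' \<inter> A = e \<inter> A" "\<forall>e\<in>T'. \<exists>e'\<in>T'. e' \<noteq> e \<and> e' \<inter> B = e \<inter> B"
      using p by (simp_all add: mated_pairs_def p')
    have finT: "finite T" "finite T'" using T(1,2) finite_complete_edges by (auto dest: finite_subset)
    have c': "card (T' - T) = c" using card_Diff_eq_if_card_eq[OF finT] T by simp
    define P where "P = (\<lambda>e. e \<inter> A) ` (T \<union> T')"
    define Q where "Q = (\<lambda>e. e \<inter> B) ` (T \<union> T')"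
    have "2 * card P \<le> t + 2 * c"
      unfolding P_def using card_image_Un_mated_le[OF finT T(6)] T c' by simp
    then have cP: "card P \<le> h" by (simp add: h_def)
    have "2 * card Q \<le> t + 2 * c"
      unfolding Q_def using card_image_Un_mated_le[OF finT(2,1) T(7)] T by (simp add: Un_commute)
    then have cQ: "card Q \<le> h" by (simp add: h_def)
    have edge: "e \<inter> A \<in> ?A" "e \<inter> B \<in> ?B" "e = (e \<inter> A) \<union> (e \<inter> B)" if "e \<in> T \<union> T'" for e
    proof -
      obtain a b where ab: "a \<in> A" "b \<in> B" "e = {a, b}" using T(1,2) \<open>e \<in> T \<union> T'\<close> by blast
      then have eq: "e \<inter> A = {a}" "e \<inter> B = {b}" using disj by auto
      show "e \<inter> A \<in> ?A" "e \<inter> B \<in> ?B" unfolding eq using ab by auto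
      show "e = (e \<inter> A) \<union> (e \<inter> B)" unfolding eq using ab by auto
    qed
    have "T \<union> T' \<subseteq> ?K P Q"
    proof
      fix e assume e: "e \<in> T \<union> T'"
      have "(e \<inter> A, e \<inter> B) \<in> P \<times> Q" using e by (simp add: P_def Q_def)
      then have "(\<lambda>(p, q). p \<union> q) (e \<inter> A, e \<inter> B) \<in> ?K P Q" by (rule imageI)
      then show "e \<in> ?K P Q" using edge(3)[OF e] by simp
    qed
    then have "p \<in> (case (P, Q) of (P, Q) \<Rightarrow> Pow (?K P Q) \<times> Pow (?K P Q))"
      unfolding p' by simp
    moreover have "P \<subseteq> ?A" "Q \<subseteq> ?B"
      unfolding P_def Q_def by (rule image_subsetI, erule edge)+
    then have "(P, Q) \<in> ?\<P>" using cP cQ by simp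
    ultimately show "p \<in> (\<Union>(P, Q)\<in>?\<P>. Pow (?K P Q) \<times> Pow (?K P Q))"
      by (rule UN_I[rotated])
  qed
  then have "card (mated_pairs t c) \<le> card (\<Union>(P, Q)\<in>?\<P>. Pow (?K P Q) \<times> Pow (?K P Q))"
    by (intro card_mono finite_UN_I[OF fin\<P>] finK)
  also have "\<dots> \<le> (\<Sum>(P, Q)\<in>?\<P>. card (Pow (?K P Q) \<times> Pow (?K P Q)))"
    unfolding case_prod_beta by (rule card_UN_le[OF fin\<P>])
  also have "\<dots> \<le> (\<Sum>(P, Q)\<in>?\<P>. 4 ^ ((2 * t) ^ 2))"
  proof (rule sum_mono)
    fix PQ assume "PQ \<in> ?\<P>"
    then obtain P Q where PQ: "PQ = (P, Q)" "P \<subseteq> ?A" "card P \<le> h" "Q \<subseteq> ?B" "card Q \<le> h" by auto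
    have finPQ: "finite P" "finite Q" using PQ finAB by (auto dest: finite_subset)
    have "card (?K P Q) \<le> card (P \<times> Q)" using finPQ by (intro card_image_le) auto
    also have "\<dots> \<le> (2 * t) * (2 * t)"
      unfolding card_cartesian_product using PQ h by (intro mult_le_mono) auto
    finally have "card (?K P Q) \<le> (2 * t) ^ 2" by (simp add: power2_eq_square)
    moreover have "card (Pow (?K P Q) \<times> Pow (?K P Q)) = 4 ^ card (?K P Q)"
      using finPQ by (simp add: card_cartesian_product card_Pow flip: power_mult_distrib)
    moreover have "(4::nat) ^ card (?K P Q) \<le> 4 ^ ((2 * t) ^ 2)"
      using \<open>card (?K P Q) \<le> (2 * t) ^ 2\<close> by (rule power_increasing) simp
    ultimately show "(case PQ of (P, Q) \<Rightarrow> card (Pow (?K P Q) \<times> Pow (?K P Q))) \<le> (case PQ of (P, Q) \<Rightarrow> 4 ^ ((2 * t) ^ 2))"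
      by (simp add: PQ(1))
  qed
  also have "\<dots> = card {P. P \<subseteq> ?A \<and> card P \<le> h} * card {Q. Q \<subseteq> ?B \<and> card Q \<le> h} * 4 ^ ((2 * t) ^ 2)"
    by (simp add: case_prod_beta card_cartesian_product)
  also have "\<dots> \<le> ((h + 1) * n ^ h) * ((h + 1) * n ^ h) * 4 ^ ((2 * t) ^ 2)"
    using finAB n by (intro mult_le_mono card_small_subsets_le order_refl) auto
  also have "\<dots> = (h + 1) ^ 2 * 4 ^ ((2 * t) ^ 2) * n ^ (2 * h)"
  proof -
    have "n ^ (2 * h) = n ^ h * n ^ h" by (simp add: mult_2 power_add)
    then show ?thesis by (simp only: power2_eq_square mult_ac)
  qed
  also have "\<dots> \<le> (2 * t + 1) ^ 2 * 4 ^ ((2 * t) ^ 2) * n ^ (t + 2 * c)"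
    using h n by (intro mult_le_mono power_mono power_increasing order_refl) auto
  finally show ?thesis .
qed

lemma abs_top_kernel_le:
  assumes "c \<le> t" "2 * t \<le> n" "r \<ge> 1"
  shows "\<bar>top_kernel (r * n - t) c\<bar> \<le> (2 * real t / real n) ^ c"
proof (cases "c = 0")
  case False
  have "n \<le> r * n" using assms by simp
  then have N: "2 * t \<le> r * n" "c \<le> r * n - t" "n \<le> 2 * (r * n - t)" using assms by linarith+
  have t0: "t > 0" "n > 0" using False assms by auto
  have "real n / (2 * real t) \<le> real (r * n - t) / real c"
  proof -
    have "real n / 2 \<le> real (r * n - t)" using N(3) by linarith
    then have "real n / 2 / real t \<le> real (r * n - t) / real t" by (rule divide_right_mono) simp
    then have "real n / (2 * real t) \<le> real (r * n - t) / real t" by simp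
    also have "\<dots> \<le> real (r * n - t) / real c" using False assms by (intro divide_left_mono) auto
    finally show ?thesis .
  qed
  then have "(real n / (2 * real t)) ^ c \<le> (real (r * n - t) / real c) ^ c" by (intro power_mono) auto
  also have "\<dots> \<le> real ((r * n - t) choose c)"
    by (rule binomial_ge_n_over_k_pow_k[OF N(2)])
  finally have "1 / real ((r * n - t) choose c) \<le> 1 / (real n / (2 * real t)) ^ c"
    using t0 by (intro divide_left_mono mult_pos_pos zero_less_power) (auto simp: zero_less_binomial_iff N)
  then show ?thesis using t0 by (simp add: top_kernel_def abs_divide power_abs power_divide)
qed (simp add: top_kernel_def)

text \<open>A pair that is not mated has a vanishing Moebius transform, and each transform is at most \<open>2\<^sup>t\<close>.\<close>

lemma abs_mobius_pair_sum_le: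
  assumes E: "E \<in> graphs"
  shows "\<bar>mobius_pair_sum (\<lambda>e. e \<inter> A) (\<lambda>e. e \<inter> B) t E\<bar>
    \<le> (\<Sum>c\<le>t. \<Sum>(T, T')\<in>mated_pairs t c. of_bool (T \<union> T' \<subseteq> E) * (4 ^ t * \<bar>top_kernel (r * n - t) c\<bar>))"
proof -
  let ?S = "subsets_of_card E t"
  let ?h = "\<lambda>T T'. inj_mobius (\<lambda>e. e \<inter> A) T * inj_mobius (\<lambda>e. e \<inter> B) T' * top_kernel (r * n - t) (card (T - T'))"
  let ?w = "\<lambda>c. 4 ^ t * \<bar>top_kernel (r * n - t) c\<bar>"
  have finE: "finite E" using finite_regular_bipartite_graph[OF fin E] .
  have cE: "card E = r * n" using card_regular_bipartite_graph[OF fin disj E] card_AB by simp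
  have sub: "E \<subseteq> complete_edges" using E by (simp add: regular_bipartite_graphs_def)
  let ?M = "SIGMA c:{..t}. {p \<in> mated_pairs t c. fst p \<union> snd p \<subseteq> E}"
  have "\<bar>mobius_pair_sum (\<lambda>e. e \<inter> A) (\<lambda>e. e \<inter> B) t E\<bar> \<le> (\<Sum>(T, T')\<in>?S \<times> ?S. \<bar>?h T T'\<bar>)"
    unfolding mobius_pair_sum_def cE sum.cartesian_product by (rule order_trans[OF sum_abs]) (simp add: case_prod_beta)
  also have "\<dots> = (\<Sum>(T, T')\<in>snd ` ?M. \<bar>?h T T'\<bar>)"
  proof (rule sum.mono_neutral_right)
    show "finite (?S \<times> ?S)" using finE by (intro finite_cartesian_product finite_subsets_of_card)
    show "snd ` ?M \<subseteq> ?S \<times> ?S" by (auto simp: mated_pairs_def)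
    show "\<forall>p\<in>?S \<times> ?S - snd ` ?M. (case p of (T, T') \<Rightarrow> \<bar>?h T T'\<bar>) = 0"
    proof
      fix p assume p: "p \<in> ?S \<times> ?S - snd ` ?M"
      obtain T T' where p': "p = (T, T')" by (cases p)
      have T: "T \<subseteq> E" "card T = t" "T' \<subseteq> E" "card T' = t" using p p' by auto
      have finT: "finite T" "finite T'" using T finE by (auto dest: finite_subset)
      have "card (T - T') \<le> t" using T finT by (metis card_mono Diff_subset)
      then have "(T, T') \<in> snd ` ?M" if "(T, T') \<in> mated_pairs t (card (T - T'))"
        using that T by (intro image_eqI[of _ snd "(card (T - T'), (T, T'))"]) simp_all
      then have "(T, T') \<notin> mated_pairs t (card (T - T'))" using p p' by blast
      then have "\<not> ((\<forall>e\<in>T. \<exists>e'\<in>T. e' \<noteq> e \<and> e' \<inter> A = e \<inter> A) \<and> (\<forall>e\<in>T'. \<exists>e'\<in>T'. e' \<noteq> e \<and> e' \<inter> B = e \<inter> B))"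
        using T sub by (simp add: mated_pairs_def)
      then consider e where "e \<in> T" "\<forall>e'\<in>T. \<not> (e' \<noteq> e \<and> e' \<inter> A = e \<inter> A)"
        | e where "e \<in> T'" "\<forall>e'\<in>T'. \<not> (e' \<noteq> e \<and> e' \<inter> B = e \<inter> B)"
        by (simp only: de_Morgan_conj ball_simps bex_simps) meson
      then have "inj_mobius (\<lambda>e. e \<inter> A) T = 0 \<or> inj_mobius (\<lambda>e. e \<inter> B) T' = 0"
      proof cases
        case 1
        then have "inj_mobius (\<lambda>e. e \<inter> A) T = 0" by (intro inj_mobius_eq_0[OF finT(1)]) auto
        then show ?thesis ..
      next
        case 2
        then have "inj_mobius (\<lambda>e. e \<inter> B) T' = 0" by (intro inj_mobius_eq_0[OF finT(2)]) auto
        then show ?thesis ..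
      qed
      then have "?h T T' = 0" by (elim disjE) simp_all
      then show "(case p of (T, T') \<Rightarrow> \<bar>?h T T'\<bar>) = 0" by (simp only: p' prod.case abs_zero)
    qed
  qed
  also have "\<dots> = (\<Sum>x\<in>?M. case snd x of (T, T') \<Rightarrow> \<bar>?h T T'\<bar>)"
  proof (subst sum.reindex)
    show "inj_on snd ?M"
    proof (rule inj_onI)
      fix x y assume xy: "x \<in> ?M" "y \<in> ?M" "snd x = snd y"
      have "fst z = card (fst (snd z) - snd (snd z))" if "z \<in> ?M" for z
      proof -
        obtain c T T' where z: "z = (c, (T, T'))" by (metis prod.exhaust)
        show ?thesis using that by (simp add: z mated_pairs_def)
      qed
      from this[OF xy(1)] this[OF xy(2)] xy(3) have "fst x = fst y" by simp
      with xy(3) show "x = y" by (rule prod_eqI[rotated])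
    qed
  qed simp
  also have "\<dots> \<le> (\<Sum>x\<in>?M. ?w (fst x))"
  proof (rule sum_mono)
    fix x assume "x \<in> ?M"
    obtain c T T' where x: "x = (c, (T, T'))" by (metis prod.exhaust)
    have "T \<union> T' \<subseteq> E" and c: "card (T - T') = c" "card T = t" "card T' = t"
      using \<open>x \<in> ?M\<close> by (simp_all add: mated_pairs_def x)
    then have finT: "finite T" "finite T'" using finE by (auto dest: finite_subset)
    have "\<bar>inj_mobius (\<lambda>e. e \<inter> A) T\<bar> * \<bar>inj_mobius (\<lambda>e. e \<inter> B) T'\<bar> \<le> 2 ^ t * 2 ^ t"
      using abs_inj_mobius_le[OF finT(1), of "\<lambda>e. e \<inter> A"] abs_inj_mobius_le[OF finT(2), of "\<lambda>e. e \<inter> B"] c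
      by (intro mult_mono) auto
    also have "\<dots> = (4::real) ^ t" by (simp flip: power_mult_distrib)
    finally show "(case snd x of (T, T') \<Rightarrow> \<bar>?h T T'\<bar>) \<le> ?w (fst x)"
      unfolding x by (auto simp: abs_mult c intro!: mult_right_mono)
  qed
  also have "\<dots> = (\<Sum>c\<le>t. \<Sum>p\<in>{p \<in> mated_pairs t c. fst p \<union> snd p \<subseteq> E}. ?w c)"
    by (subst sum.Sigma) (auto simp: finite_mated_pairs case_prod_beta)
  also have "\<dots> = (\<Sum>c\<le>t. \<Sum>(T, T')\<in>mated_pairs t c. of_bool (T \<union> T' \<subseteq> E) * ?w c)"
    unfolding sum.inter_filter[OF finite_mated_pairs] case_prod_beta
    by (intro sum.cong refl) simp
  finally show ?thesis .
qed

text \<open>The powers of \<open>n\<close> cancel: there are \<open>O(n\<^sup>t\<^sup>+\<^sup>2\<^sup>c)\<close> pairs, each present with probability \<open>O(n\<^sup>-\<^sup>t\<^sup>-\<^sup>c)\<close> and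
  weighted by \<open>O(n\<^sup>-\<^sup>c)\<close>.\<close>

theorem sum_abs_mobius_pair_sum_le:
  assumes r: "r \<ge> 1" and n: "2 * (2 * t + 1 + 2 * r ^ 2) \<le> n"
  shows "(\<Sum>E\<in>graphs. \<bar>mobius_pair_sum (\<lambda>e. e \<inter> A) (\<lambda>e. e \<inter> B) t E\<bar>) \<le> mean_bound r t * real (card graphs)"
proof -
  let ?w = "\<lambda>c. 4 ^ t * \<bar>top_kernel (r * n - t) c\<bar>"
  have "n \<le> r * n" using r by simp
  then have rn: "2 * (2 * t + 1 + 2 * r ^ 2) \<le> r * n" using n by (rule order_trans[rotated])
  have n1: "n \<ge> 1" "2 * t \<le> n" using n by auto
  have count: "(\<Sum>E\<in>graphs. of_bool (W \<subseteq> E) :: real) = real (num_containing W)" for W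
  proof -
    have "(\<Sum>E\<in>graphs. of_bool (W \<subseteq> E) :: real) = real (card (graphs \<inter> {E. W \<subseteq> E}))"
      by (intro sum_of_bool_eq finite_graphs)
    also have "graphs \<inter> {E. W \<subseteq> E} = {E \<in> graphs. W \<subseteq> E}" by blast
    finally show ?thesis by (simp only: num_containing_def)
  qed
  have "(\<Sum>E\<in>graphs. \<bar>mobius_pair_sum (\<lambda>e. e \<inter> A) (\<lambda>e. e \<inter> B) t E\<bar>)
     \<le> (\<Sum>E\<in>graphs. \<Sum>c\<le>t. \<Sum>p\<in>mated_pairs t c. of_bool (fst p \<union> snd p \<subseteq> E) * ?w c)"
    using abs_mobius_pair_sum_le[of _ t] by (intro sum_mono) (simp add: case_prod_beta)
  also have "\<dots> = (\<Sum>c\<le>t. \<Sum>p\<in>mated_pairs t c. (\<Sum>E\<in>graphs. of_bool (fst p \<union> snd p \<subseteq> E)) * ?w c)"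
    unfolding sum_distrib_right by (subst sum.swap, intro sum.cong refl sum.swap)
  also have "\<dots> = (\<Sum>c\<le>t. \<Sum>p\<in>mated_pairs t c. real (num_containing (fst p \<union> snd p)) * ?w c)"
    by (simp only: count)
  also have "\<dots> \<le> (\<Sum>c\<le>t. \<Sum>p\<in>mated_pairs t c.
      ((2 * real r / real n) ^ (t + c) * real (card graphs)) * (4 ^ t * (2 * real t / real n) ^ c))"
  proof (rule sum_mono, rule sum_mono, rule mult_mono)
    fix c p assume c: "c \<in> {..t}" and p: "p \<in> mated_pairs t c"
    obtain T T' where p': "p = (T, T')" by (cases p)
    have T: "T \<subseteq> complete_edges" "T' \<subseteq> complete_edges" "card T = t" "card T' = t" "card (T - T') = c"
      using p by (auto simp: mated_pairs_def p')
    have finT: "finite T" "finite T'" using T(1,2) finite_complete_edges by (auto dest: finite_subset)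
    have "T \<union> T' = (T - T') \<union> T'" by auto
    then have "card (T \<union> T') = card (T - T') + card T'"
      using finT by (metis card_Un_disjoint Diff_disjoint Int_commute finite_Diff)
    then have cU: "card (T \<union> T') = t + c" using T by simp
    have "real (num_containing (T \<union> T')) \<le> (2 * real r / real n) ^ card (T \<union> T') * real (card graphs)"
      by (rule num_containing_le[OF _ _ rn]) (use T c cU in auto)
    then show "real (num_containing (fst p \<union> snd p)) \<le> (2 * real r / real n) ^ (t + c) * real (card graphs)"
      unfolding cU by (simp add: p')
    show "4 ^ t * \<bar>top_kernel (r * n - t) c\<bar> \<le> 4 ^ t * (2 * real t / real n) ^ c"
      using abs_top_kernel_le[of c t] c n1 r by simp
  qed auto
  also have "\<dots> = (\<Sum>c\<le>t. real (card (mated_pairs t c)) *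
      (((2 * real r / real n) ^ (t + c) * real (card graphs)) * (4 ^ t * (2 * real t / real n) ^ c)))"
    by simp
  also have "\<dots> \<le> (\<Sum>c\<le>t. ((2 * real t + 1) ^ 2 * 4 ^ ((2 * t) ^ 2) * real n ^ (t + 2 * c)) *
      (((2 * real r / real n) ^ (t + c) * real (card graphs)) * (4 ^ t * (2 * real t / real n) ^ c)))"
  proof (intro sum_mono mult_right_mono)
    fix c assume "c \<in> {..t}"
    then have "card (mated_pairs t c) \<le> (2 * t + 1) ^ 2 * 4 ^ ((2 * t) ^ 2) * n ^ (t + 2 * c)"
      using n1 by (intro card_mated_pairs_le) auto
    then have "real (card (mated_pairs t c)) \<le> real ((2 * t + 1) ^ 2 * 4 ^ ((2 * t) ^ 2) * n ^ (t + 2 * c))"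
      by (simp only: of_nat_le_iff)
    also have "\<dots> = (2 * real t + 1) ^ 2 * 4 ^ ((2 * t) ^ 2) * real n ^ (t + 2 * c)" by simp
    finally show "real (card (mated_pairs t c)) \<le> (2 * real t + 1) ^ 2 * 4 ^ ((2 * t) ^ 2) * real n ^ (t + 2 * c)" .
  qed auto
  also have "\<dots> = (\<Sum>c\<le>t. 4 ^ t * (2 * real t + 1) ^ 2 * 4 ^ ((2 * t) ^ 2) * (2 * real t) ^ c * (2 * real r) ^ (t + c)
      * real (card graphs))"
  proof (intro sum.cong refl)
    fix c
    have "t + 2 * c = (t + c) + c" by simp
    then have "real n ^ (t + 2 * c) = real n ^ (t + c) * real n ^ c" by (simp only: power_add)
    then show "((2 * real t + 1) ^ 2 * 4 ^ ((2 * t) ^ 2) * real n ^ (t + 2 * c)) *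
      (((2 * real r / real n) ^ (t + c) * real (card graphs)) * (4 ^ t * (2 * real t / real n) ^ c))
      = 4 ^ t * (2 * real t + 1) ^ 2 * 4 ^ ((2 * t) ^ 2) * (2 * real t) ^ c * (2 * real r) ^ (t + c) * real (card graphs)"
      using n1 by (simp add: power_divide)
  qed
  also have "\<dots> = mean_bound r t * real (card graphs)" by (simp add: mean_bound_def sum_distrib_right)
  finally show ?thesis .
qed

end

section \<open>Existence of regular bipartite graphs\<close>

text \<open>A circulant graph: the left vertex \<open>a\<close> is joined to the right vertices with indices
  \<open>a, \<dots>, a + r - 1\<close> modulo \<open>n\<close>. Without this the uniform distribution would be meaningless.\<close>

lemma regular_bipartite_graphs_nonempty:
  assumes "r \<le> n"
  shows "regular_bipartite_graphs r {..<n} {n..<2 * n} \<noteq> {}"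
proof -
  define sh where "sh = (\<lambda>a s. if a + s < n then n + (a + s) else a + s)"
  define E where "E = {{a, sh a s} | a s. a < n \<and> s < r}"
  have sh: "n \<le> sh a s" "sh a s < 2 * n" if "a < n" "s < r" for a s
    using that assms by (auto simp: sh_def)
  have EE: "e \<in> E \<longleftrightarrow> (\<exists>a s. e = {a, sh a s} \<and> a < n \<and> s < r)" for e
    by (simp add: E_def)
  have "E \<subseteq> {{a, b} | a b. a \<in> {..<n} \<and> b \<in> {n..<2 * n}}"
  proof
    fix e assume "e \<in> E"
    then obtain a s where e: "e = {a, sh a s}" "a < n" "s < r" by (auto simp only: EE)
    then have "a \<in> {..<n}" "sh a s \<in> {n..<2 * n}" using sh[of a s] by auto
    then show "e \<in> {{a, b} | a b. a \<in> {..<n} \<and> b \<in> {n..<2 * n}}" unfolding e(1) by blast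
  qed
  moreover have "vdegree E x = r" if x: "x \<in> {..<n} \<union> {n..<2 * n}" for x
  proof (cases "x < n")
    case True
    have "{e \<in> E. x \<in> e} = (\<lambda>s. {x, sh x s}) ` {..<r}"
    proof (intro equalityI subsetI)
      fix e assume "e \<in> {e \<in> E. x \<in> e}"
      then obtain a s where e: "e = {a, sh a s}" "a < n" "s < r" "x \<in> e" by (auto simp only: EE)
      then have "x = a" using sh(1)[of a s] True by auto
      then show "e \<in> (\<lambda>s. {x, sh x s}) ` {..<r}" using e by auto
    next
      fix e assume "e \<in> (\<lambda>s. {x, sh x s}) ` {..<r}"
      then obtain s where "s < r" "e = {x, sh x s}" by auto
      then show "e \<in> {e \<in> E. x \<in> e}" using True by (auto simp only: EE)
    qed
    moreover have "inj_on (\<lambda>s. {x, sh x s}) {..<r}"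
    proof (rule inj_onI)
      fix s s' assume s: "s \<in> {..<r}" "s' \<in> {..<r}" "{x, sh x s} = {x, sh x s'}"
      then have "sh x s = sh x s'" by (auto simp: doubleton_eq_iff)
      then show "s = s'" using s True assms by (auto simp: sh_def split: if_splits)
    qed
    ultimately show ?thesis by (simp add: vdegree_def card_image)
  next
    case False
    define y where "y = x - n"
    have y: "x = n + y" "y < n" using False x by (auto simp: y_def)
    define g where "g = (\<lambda>s. if s \<le> y then y - s else y + n - s)"
    have g: "g s < n" "sh (g s) s = x" if "s < r" for s
      using that y assms by (auto simp: g_def sh_def)
    have "{e \<in> E. x \<in> e} = (\<lambda>s. {g s, x}) ` {..<r}"
    proof (intro equalityI subsetI)
      fix e assume "e \<in> {e \<in> E. x \<in> e}"
      then obtain a s where e: "e = {a, sh a s}" "a < n" "s < r" "x \<in> e" by (auto simp only: EE)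
      have "x = sh a s" using e False by auto
      then have "a = g s" using y e(2,3) assms by (auto simp: sh_def g_def split: if_splits)
      then show "e \<in> (\<lambda>s. {g s, x}) ` {..<r}" using e \<open>x = sh a s\<close> by auto
    next
      fix e assume "e \<in> (\<lambda>s. {g s, x}) ` {..<r}"
      then obtain s where s: "s < r" "e = {g s, x}" by auto
      then have "e = {g s, sh (g s) s}" "g s < n" using g by auto
      then show "e \<in> {e \<in> E. x \<in> e}" using s EE by blast
    qed
    moreover have "inj_on (\<lambda>s. {g s, x}) {..<r}"
    proof (rule inj_onI)
      fix s s' assume s: "s \<in> {..<r}" "s' \<in> {..<r}" "{g s, x} = {g s', x}"
      then have "g s = g s'" by (auto simp: doubleton_eq_iff)
      then show "s = s'" using s y assms by (auto simp: g_def split: if_splits)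
    qed
    ultimately show ?thesis by (simp add: vdegree_def card_image)
  qed
  ultimately have "E \<in> regular_bipartite_graphs r {..<n} {n..<2 * n}"
    by (simp add: regular_bipartite_graphs_def)
  then show ?thesis by blast
qed

section \<open>Convergence in probability\<close>

text \<open>Markov's inequality together with a union bound over \<open>t\<close>.\<close>

lemma (in bipartition) card_unbounded_le:
  assumes r: "r \<ge> 1" and n: "2 * (2 * m + 1 + 2 * r ^ 2) \<le> n" and K: "K > 0"
  shows "real (card {E \<in> graphs. \<exists>t\<in>{1..m}. \<bar>mobius_pair_sum (\<lambda>e. e \<inter> A) (\<lambda>e. e \<inter> B) t E\<bar> > K})
    \<le> (\<Sum>t\<in>{1..m}. mean_bound r t) / K * real (card graphs)"
proof -
  let ?Z = "\<lambda>t E. \<bar>mobius_pair_sum (\<lambda>e. e \<inter> A) (\<lambda>e. e \<inter> B) t E\<bar>"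
  let ?bad = "{E \<in> graphs. \<exists>t\<in>{1..m}. ?Z t E > K}"
  have "K * real (card ?bad) = (\<Sum>E\<in>?bad. K)" by simp
  also have "\<dots> \<le> (\<Sum>E\<in>?bad. \<Sum>t\<in>{1..m}. ?Z t E)"
  proof (rule sum_mono)
    fix E assume "E \<in> ?bad"
    then obtain t where t: "t \<in> {1..m}" "K < ?Z t E" by blast
    then have "?Z t E \<le> (\<Sum>t\<in>{1..m}. ?Z t E)" by (intro member_le_sum) auto
    with t show "K \<le> (\<Sum>t\<in>{1..m}. ?Z t E)" by linarith
  qed
  also have "\<dots> \<le> (\<Sum>E\<in>graphs. \<Sum>t\<in>{1..m}. ?Z t E)"
    using finite_graphs by (intro sum_mono2) (auto intro: sum_nonneg)
  also have "\<dots> = (\<Sum>t\<in>{1..m}. \<Sum>E\<in>graphs. ?Z t E)" by (rule sum.swap)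
  also have "\<dots> \<le> (\<Sum>t\<in>{1..m}. mean_bound r t * real (card graphs))"
    using n by (intro sum_mono sum_abs_mobius_pair_sum_le r) auto
  also have "\<dots> = (\<Sum>t\<in>{1..m}. mean_bound r t) * real (card graphs)"
    by (simp only: sum_distrib_right)
  finally show ?thesis using K by (simp add: field_simps)
qed

lemma mean_bound_nonneg: "mean_bound r t \<ge> 0"
  unfolding mean_bound_def by (intro sum_nonneg) auto

theorem theorem1p1:
  fixes r i k :: nat
  assumes "r \<ge> 1"
    and "(r \<le> 10 \<and> i + k \<le> 100 \<and> k \<le> 27) \<or> i + k \<le> 29"
  shows "(\<lambda>n::nat. measure_pmf.prob
            (pmf_of_set (regular_bipartite_graphs r {..<n} {n..<2 * n}))
            {E. (fwd_diff ^^ k) (log_matching_diff r (2 * n) E) i \<ge> 0}) \<longlonglongrightarrow> 1"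
proof (rule LIMSEQ_I)
  fix \<delta> :: real assume \<delta>: "\<delta> > 0"
  \<comment> \<open>This leaves room for the second differences that are used when \<open>k < 2\<close>.\<close>
  define m where "m = i + k + 3"
  define C where "C = (\<Sum>t\<in>{1..m}. mean_bound r t)"
  \<comment> \<open>Any \<open>K\<close> with \<open>C / K < \<delta>\<close> will do; the summand 1 covers \<open>C = 0\<close>.\<close>
  define K where "K = (C + 1) / \<delta>"
  have C: "C \<ge> 0" unfolding C_def by (intro sum_nonneg mean_bound_nonneg)
  then have K: "K > 0" using \<delta> by (simp add: K_def)
  have CK: "C / K < \<delta>" using C \<delta> by (simp add: K_def field_simps)
  let ?G = "\<lambda>n. regular_bipartite_graphs r {..<n} {n..<2 * n}"
  let ?Z = "\<lambda>n t E. \<bar>mobius_pair_sum (\<lambda>e. e \<inter> {..<n}) (\<lambda>e. e \<inter> {n..<2 * n}) t E\<bar>"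
  let ?good = "\<lambda>n. {E. (fwd_diff ^^ k) (log_matching_diff r (2 * n) E) i \<ge> 0}"
  have "eventually (\<lambda>x. (fwd_diff ^^ k) (log_matching_diff r (2 * fst x) (snd x)) i \<ge> 0)
      (bounded_graphs (\<lambda>n. {..<n}) (\<lambda>n. {n..<2 * n}) r m K)"
    by (rule eventually_diff_nonneg) (use assms in \<open>auto simp: m_def\<close>)
  then obtain n0 where n0: "\<And>n E. n \<ge> n0 \<Longrightarrow> E \<in> ?G n \<Longrightarrow> \<forall>t\<in>{1..m}. ?Z n t E \<le> K \<Longrightarrow> E \<in> ?good n"
    by (subst (asm) eventually_bounded_graphs) (use assms in auto)
  show "\<exists>n1. \<forall>n\<ge>n1. norm (measure_pmf.prob (pmf_of_set (?G n)) (?good n) - 1) < \<delta>"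
  proof (intro exI allI impI)
    fix n assume n: "n \<ge> max n0 (r + 2 * (2 * m + 1 + 2 * r ^ 2))"
    interpret bipartition "{..<n}" "{n..<2 * n}" n r
      by unfold_locales auto
    have ne: "?G n \<noteq> {}" using n by (intro regular_bipartite_graphs_nonempty) auto
    have cpos: "real (card (?G n)) > 0" using ne finite_graphs by (simp add: card_gt_0_iff)
    let ?bad = "{E \<in> ?G n. \<exists>t\<in>{1..m}. ?Z n t E > K}"
    have "?G n \<subseteq> (?G n \<inter> ?good n) \<union> ?bad"
    proof
      fix E assume E: "E \<in> ?G n"
      show "E \<in> (?G n \<inter> ?good n) \<union> ?bad"
      proof (cases "\<forall>t\<in>{1..m}. ?Z n t E \<le> K")
        case True
        then have "E \<in> ?good n" using n0[OF _ E] n by simp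
        then show ?thesis using E by blast
      next
        case False
        then have "E \<in> ?bad" using E by (simp add: not_le)
        then show ?thesis by blast
      qed
    qed
    then have "card (?G n) \<le> card ((?G n \<inter> ?good n) \<union> ?bad)"
      using finite_graphs by (intro card_mono) auto
    also have "\<dots> \<le> card (?G n \<inter> ?good n) + card ?bad" by (rule card_Un_le)
    finally have "real (card (?G n)) \<le> real (card (?G n \<inter> ?good n)) + real (card ?bad)" by linarith
    also have "real (card ?bad) \<le> C / K * real (card (?G n))"
      unfolding C_def using n by (intro card_unbounded_le assms(1) K) auto
    finally have "1 - C / K \<le> real (card (?G n \<inter> ?good n)) / real (card (?G n))"
      using cpos by (simp add: field_simps)
    also have "\<dots> = measure_pmf.prob (pmf_of_set (?G n)) (?good n)"
      using ne finite_graphs by (simp add: measure_pmf_of_set)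
    finally have "measure_pmf.prob (pmf_of_set (?G n)) (?good n) > 1 - \<delta>" using CK by linarith
    moreover have "measure_pmf.prob (pmf_of_set (?G n)) (?good n) \<le> 1" by simp
    ultimately show "norm (measure_pmf.prob (pmf_of_set (?G n)) (?good n) - 1) < \<delta>" by simp
  qed
qed

end
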